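(* Let $m\ge 1$ and let $L$ be a uniformly elliptic operator of order $2m$ on $\mathbb{R}^n$ with constant coefficients involving only the highest order derivatives. (i) If $n=2m$, there is some $r_L>0$ such that the fundamental solution $K_L$ satisfies $K_L(x,y)>0$ whenever $x-y\in B_{r_L}(0)$, $x\neq y$. (ii) If $n=2m+1$, the fundamental solution $K_L$ is always positive, i.e. $K_L(x,y)>0$ for all $x\ne y$.
   Context: Operators: $L=(-1)^m Q\left(\frac{\partial}{\partial x_1},\dots,\frac{\partial}{\partial x_n}\right)$, where $Q(\xi)=\sum_{i_1,\dots,i_{2m}=1}^n A_{i_1,\dots,i_{2m}}\xi_{i_1}\cdots\xi_{i_{2m}}$ is a real $2m$-homogeneous polynomial on $\mathbb{R}^n$, called the symbol of $L$. Uniform ellipticity: there is $\lambda>0$ with $Q(\xi)\ge\lambda|\xi|^{2m}$ for all $\xi\in\mathbb{R}^n$. Fundamental solution: $K_L$ denotes John's fundamental solution, i.e. for $x\ne y$ $$K_L(x,y)=-\frac{1}{4(2\pi)^{n-1}}(-\Delta_y)^{\frac{n+1-2m}{2}}\int_{|\xi|=1}\frac{|(x-y)\cdot\xi|}{Q(\xi)}\,d\mathcal{H}^{n-1}(\xi)\quad (n\ge 2m\text{ odd}),$$ $$K_L(x,y)=-\frac{1}{(2\pi)^{n}}(-\Delta_y)^{\frac{n-2m}{2}}\int_{|\xi|=1}\frac{\log|(x-y)\cdot\xi|}{Q(\xi)}\,d\mathcal{H}^{n-1}(\xi)\quad (n\ge 2m\text{ even}).$$ It satisfies $\int_{\mathbb{R}^n}K_L(x,y)L\psi(y)\,dy=\psi(x)$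 for all $\psi\in C_0^\infty(\mathbb{R}^n)$. $B_r(0)$ is the open ball of radius $r$ about $0$ in $\mathbb{R}^n$; $\mathcal{H}^k$ is the $k$-dimensional Hausdorff measure. *)

theory Defs
  imports "HOL-Analysis.Analysis"
begin

subsection \<open>Hausdorff measure\<close>

text \<open>
  Normalised so that in dimension k it agrees with k-dimensional Lebesgue measure. The empty set
  is given weight 0 explicitly because 0 ^ 0 = 1, so that countable covers may be padded by empty
  sets also for k = 0. Boundedness is required because the diameter of an unbounded set is an
  unspecified real number.
\<close>

definition hausdorff_weight :: "nat \<Rightarrow> 'a::metric_space set \<Rightarrow> ennreal" where
  "hausdorff_weight k U =
     (if U = {} then 0 else ennreal (unit_ball_vol (real k) * (diameter U / 2) ^ k))"

definition hausdorff_premeasure :: "nat \<Rightarrow> real \<Rightarrow> 'a::metric_space set \<Rightarrow> ennreal" where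
  "hausdorff_premeasure k \<delta> S =
     (INF U \<in> {U :: nat \<Rightarrow> 'a set. S \<subseteq> (\<Union>i. U i) \<and> (\<forall>i. bounded (U i) \<and> diameter (U i) \<le> \<delta>)}.
        \<Sum>i. hausdorff_weight k (U i))"

definition hausdorff_outer_measure :: "nat \<Rightarrow> 'a::metric_space set \<Rightarrow> ennreal" where
  "hausdorff_outer_measure k S = (SUP \<delta> \<in> {0<..}. hausdorff_premeasure k \<delta> S)"

definition hausdorff_measure :: "nat \<Rightarrow> 'a::metric_space measure" where
  "hausdorff_measure k = measure_of UNIV (sets borel) (hausdorff_outer_measure k)"


subsection \<open>Homogeneous operators with constant coefficients\<close>

definition partial_deriv :: "'n \<Rightarrow> (real^'n \<Rightarrow> real) \<Rightarrow> real^'n \<Rightarrow> real" where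
  "partial_deriv i u x = deriv (\<lambda>t. u (x + t *\<^sub>R axis i 1)) 0"

text \<open>
  A tuple of 2 m indices is a list \<open>J\<close> of length 2 m, so that a coefficient family is a
  function on lists; only its values on lists of length 2 m matter.
\<close>

definition homogeneous_form :: "nat \<Rightarrow> ('n list \<Rightarrow> real) \<Rightarrow> real^'n \<Rightarrow> real" where
  "homogeneous_form m A \<xi> = (\<Sum>J | length J = 2 * m. A J * (\<Prod>i\<leftarrow>J. \<xi> $ i))"

definition homogeneous_operator ::
    "nat \<Rightarrow> ('n list \<Rightarrow> real) \<Rightarrow> (real^'n \<Rightarrow> real) \<Rightarrow> real^'n \<Rightarrow> real" where
  "homogeneous_operator m A u x =
     (-1) ^ m * (\<Sum>J | length J = 2 * m. A J * foldr partial_deriv J u x)"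

text \<open>\<open>L\<close> has constant coefficients, only derivatives of order 2 m, and symbol \<open>Q\<close>.\<close>

definition operator_with_symbol ::
    "nat \<Rightarrow> ((real^'n \<Rightarrow> real) \<Rightarrow> real^'n \<Rightarrow> real) \<Rightarrow> (real^'n \<Rightarrow> real) \<Rightarrow> bool" where
  "operator_with_symbol m L Q \<longleftrightarrow> (\<exists>A. L = homogeneous_operator m A \<and> Q = homogeneous_form m A)"

definition uniformly_elliptic :: "nat \<Rightarrow> (real^'n \<Rightarrow> real) \<Rightarrow> bool" where
  "uniformly_elliptic m Q \<longleftrightarrow> (\<exists>c>0. \<forall>\<xi>. Q \<xi> \<ge> c * norm \<xi> ^ (2 * m))"


subsection \<open>John's fundamental solution\<close>

definition neg_laplacian :: "(real^'n \<Rightarrow> real) \<Rightarrow> real^'n \<Rightarrow> real" where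
  "neg_laplacian u x = - (\<Sum>i\<in>UNIV. partial_deriv i (partial_deriv i u) x)"

text \<open>
  The operator of order 2 m with symbol \<open>Q\<close> on \<open>\<real>\<^sup>n\<close>, where n = \<open>CARD('n)\<close>. Meaningful for
  n \<open>\<ge>\<close> 2 m (so that the natural number subtractions do not truncate) and x \<open>\<noteq>\<close> y.
\<close>

definition fundamental_solution ::
    "nat \<Rightarrow> (real^'n \<Rightarrow> real) \<Rightarrow> real^'n \<Rightarrow> real^'n \<Rightarrow> real" where
  "fundamental_solution m Q x y =
     (if odd CARD('n) then
        - (1 / (4 * (2 * pi) ^ (CARD('n) - 1))) *
        (neg_laplacian ^^ ((CARD('n) + 1 - 2 * m) div 2))
          (\<lambda>y. LINT \<xi>:sphere 0 1|hausdorff_measure (CARD('n) - 1). \<bar>(x - y) \<bullet> \<xi>\<bar> / Q \<xi>) y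
      else
        - (1 / (2 * pi) ^ CARD('n)) *
        (neg_laplacian ^^ ((CARD('n) - 2 * m) div 2))
          (\<lambda>y. LINT \<xi>:sphere 0 1|hausdorff_measure (CARD('n) - 1). ln \<bar>(x - y) \<bullet> \<xi>\<bar> / Q \<xi>) y)"

end

theory Submission
  imports Defs
begin

text \<open>
  The Hausdorff measure is a metric outer measure, hence a Borel measure, and its restriction to
  the unit sphere is finite, nonzero and invariant under reflections.

  If n = 2 m, the integrand \<open>ln |z \<bullet> \<xi>| / Q \<xi>\<close> is negative for \<open>0 < |z| < 1\<close>. Its integral is
  finite: by invariance, the logarithm can be averaged over the direction of \<open>z\<close>, which reduces
  the claim to the volume of slabs in the unit ball.

  If n = 2 m + 1, then K is a positive multiple of \<open>\<Delta> F\<close> with \<open>F z = \<integral> |z \<bullet> \<xi>| / Q \<xi>\<close>. Reflections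
  that take \<open>z\<close> to a fixed axis show that \<open>F\<close> is twice differentiable away from the origin. If
  \<open>Q \<le> \<Lambda>\<close> on the sphere, then \<open>F = c |z| / \<Lambda> + G\<close>, where \<open>G z = \<integral> |z \<bullet> \<xi>| (1 / Q \<xi> - 1 / \<Lambda>)\<close> is
  convex, so that \<open>\<Delta> F \<ge> c (n - 1) / (\<Lambda> |z|) > 0\<close>.
\<close>

subsection \<open>Hausdorff measure is a Borel measure\<close>

text \<open>Three default values decide what must be proved. \<open>measure_of\<close> yields the
  null measure unless the set function is countably additive on the generated \<sigma>-algebra, the
  integral of a nonintegrable function is 0, and \<open>deriv\<close> is unspecified where no
  derivative exists. A strict sign therefore needs additivity on Borel sets and a sphere of positive
  measure, an integrable logarithm, and existence of both partial derivatives. The last is not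
  immediate: \<open>\<bar>z \<bullet> \<xi>\<bar>\<close> has a kink where \<open>\<xi>\<close> is
  orthogonal to \<open>z\<close>, and this set moves with \<open>z\<close>, so the integrand cannot
  be differentiated as it stands. The surface measure of the sphere is never computed. That it is
  positive and finite suffices, which is why crude covering and packing constants do. Reflections
  replace the rotation group, since a single one interchanges any two given vectors of equal norm;
  no polar coordinates are needed.\<close>

lemma hausdorff_weight_mono:
  assumes "U \<subseteq> V" "bounded V"
  shows "hausdorff_weight k U \<le> hausdorff_weight k V"
  using assms diameter_subset[OF assms] diameter_ge_0[OF bounded_subset[OF assms(2,1)]]
  by (auto simp: hausdorff_weight_def intro!: ennreal_leI mult_left_mono power_mono)

text \<open>The bound on the diameter is moved into the weight as the value \<infinity>. The library
  construction \<open>outer_measure\<close>, which puts no condition on the size of covering sets,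
  then applies.\<close>

definition restricted_weight :: "nat \<Rightarrow> real \<Rightarrow> 'a::metric_space set \<Rightarrow> ennreal" where
  "restricted_weight k \<delta> U = (if bounded U \<and> diameter U \<le> \<delta> then hausdorff_weight k U else \<infinity>)"

lemma restricted_weight_increasing:
  "increasing UNIV (restricted_weight k \<delta> :: 'a::metric_space set \<Rightarrow> ennreal)"
  unfolding increasing_def
proof (intro ballI impI)
  fix U V :: "'a set"
  assume "U \<subseteq> V"
  show "restricted_weight k \<delta> U \<le> restricted_weight k \<delta> V"
  proof (cases "bounded V \<and> diameter V \<le> \<delta>")
    case True
    then have "bounded U \<and> diameter U \<le> \<delta>"
      using \<open>U \<subseteq> V\<close> bounded_subset diameter_subset order_trans by metis
    then show ?thesis
      unfolding restricted_weight_def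
      by (simp only: True simp_thms if_True) (rule hausdorff_weight_mono[OF \<open>U \<subseteq> V\<close> conjunct1[OF True]])
  next
    case False
    then have "restricted_weight k \<delta> V = \<infinity>" unfolding restricted_weight_def by metis
    then show ?thesis by simp
  qed
qed

lemma restricted_weight_positive: "\<delta> \<ge> 0 \<Longrightarrow> positive UNIV (restricted_weight k \<delta>)"
  by (simp add: positive_def restricted_weight_def hausdorff_weight_def)

text \<open>\<open>outer_measure\<close> ranges over disjoint covers only. This costs nothing,
  because a monotone weight does not grow when a cover is made disjoint. Conversely, one
  inadmissible covering set makes the whole sum infinite.\<close>

lemma hausdorff_premeasure_eq_outer_measure:
  fixes S :: "'a::metric_space set"
  assumes "\<delta> \<ge> 0"
  shows "hausdorff_premeasure k \<delta> S = outer_measure UNIV (restricted_weight k \<delta>) S"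
proof (rule antisym)
  interpret sigma_algebra "UNIV :: 'a set" UNIV
    using sigma_algebra_Pow[of UNIV] by simp
  show "outer_measure UNIV (restricted_weight k \<delta>) S \<le> hausdorff_premeasure k \<delta> S"
    unfolding hausdorff_premeasure_def
  proof (rule INF_greatest)
    fix U :: "nat \<Rightarrow> 'a set"
    assume U: "U \<in> {U. S \<subseteq> (\<Union>i. U i) \<and> (\<forall>i. bounded (U i) \<and> diameter (U i) \<le> \<delta>)}"
    have "outer_measure UNIV (restricted_weight k \<delta>) S \<le> (\<Sum>i. restricted_weight k \<delta> (U i))"
      using U assms by (intro outer_measure_le restricted_weight_positive restricted_weight_increasing) auto
    also have "\<dots> = (\<Sum>i. hausdorff_weight k (U i))"
      using U by (simp add: restricted_weight_def)
    finally show "outer_measure UNIV (restricted_weight k \<delta>) S \<le> (\<Sum>i. hausdorff_weight k (U i))" .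
  qed
  show "hausdorff_premeasure k \<delta> S \<le> outer_measure UNIV (restricted_weight k \<delta>) S"
    unfolding outer_measure_def
  proof (rule INF_greatest)
    fix A :: "nat \<Rightarrow> 'a set"
    assume A: "A \<in> {A. range A \<subseteq> UNIV \<and> disjoint_family A \<and> S \<subseteq> (\<Union>i. A i)}"
    show "hausdorff_premeasure k \<delta> S \<le> (\<Sum>i. restricted_weight k \<delta> (A i))"
    proof (cases "\<forall>i. bounded (A i) \<and> diameter (A i) \<le> \<delta>")
      case True
      then have "hausdorff_premeasure k \<delta> S \<le> (\<Sum>i. hausdorff_weight k (A i))"
        unfolding hausdorff_premeasure_def using A by (intro INF_lower) auto
      then show ?thesis using True by (simp add: restricted_weight_def)
    next
      case False
      then obtain i where "\<not> (bounded (A i) \<and> diameter (A i) \<le> \<delta>)" by blast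
      then have "restricted_weight k \<delta> (A i) = \<infinity>"
        unfolding restricted_weight_def by metis
      moreover have "(\<Sum>j\<in>{i}. restricted_weight k \<delta> (A j)) \<le> (\<Sum>i. restricted_weight k \<delta> (A i))"
        by (intro sum_le_suminf) auto
      ultimately have "(\<Sum>i. restricted_weight k \<delta> (A i)) = \<infinity>"
        by (simp add: top_unique)
      then show ?thesis by simp
    qed
  qed
qed

lemma hausdorff_premeasure_space:
  fixes \<delta> :: real
  assumes "\<delta> \<ge> 0"
  shows "outer_measure_space UNIV (hausdorff_premeasure k \<delta> :: 'a::metric_space set \<Rightarrow> ennreal)"
proof -
  interpret sigma_algebra "UNIV :: 'a set" UNIV
    using sigma_algebra_Pow[of UNIV] by simp
  have "hausdorff_premeasure k \<delta> = (outer_measure UNIV (restricted_weight k \<delta>) :: 'a set \<Rightarrow> ennreal)"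
    using hausdorff_premeasure_eq_outer_measure[OF assms] by auto
  then show ?thesis
    using outer_measure_space_outer_measure[OF restricted_weight_positive[OF assms] restricted_weight_increasing]
    by simp
qed

lemma hausdorff_premeasure_antimono:
  assumes "\<delta> \<le> \<epsilon>"
  shows "hausdorff_premeasure k \<epsilon> S \<le> hausdorff_premeasure k \<delta> S"
  unfolding hausdorff_premeasure_def using assms
  by (intro INF_superset_mono) (auto intro: order_trans)

text \<open>The axioms pass to the supremum over the scales: subadditivity at one fixed scale is
  already bounded by the sum of the suprema.\<close>

lemma hausdorff_outer_measure_space:
  "outer_measure_space UNIV (hausdorff_outer_measure k :: 'a::metric_space set \<Rightarrow> ennreal)"
  unfolding outer_measure_space_def
proof (intro conjI)
  note pre = hausdorff_premeasure_space[of _ k, where 'a = 'a, unfolded outer_measure_space_def]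
  show "positive UNIV (hausdorff_outer_measure k :: 'a set \<Rightarrow> ennreal)"
    using pre by (simp add: positive_def hausdorff_outer_measure_def)
  show "increasing UNIV (hausdorff_outer_measure k :: 'a set \<Rightarrow> ennreal)"
    unfolding increasing_def hausdorff_outer_measure_def
  proof (intro ballI impI SUP_mono bexI)
    fix X Y :: "'a set" and \<delta> :: real
    assume "X \<subseteq> Y" "\<delta> \<in> {0<..}"
    then show "hausdorff_premeasure k \<delta> X \<le> hausdorff_premeasure k \<delta> Y"
      using pre[of \<delta>] by (simp add: increasing_def)
  qed
  show "countably_subadditive UNIV (hausdorff_outer_measure k :: 'a set \<Rightarrow> ennreal)"
    unfolding countably_subadditive_def
  proof (intro allI ballI impI)
    fix A :: "nat \<Rightarrow> 'a set"
    assume "range A \<subseteq> UNIV" "disjoint_family A"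
    show "hausdorff_outer_measure k (\<Union>i. A i) \<le> (\<Sum>i. hausdorff_outer_measure k (A i))"
      unfolding hausdorff_outer_measure_def[of k "\<Union>i. A i"]
    proof (rule SUP_least)
      fix \<delta> :: real assume d: "\<delta> \<in> {0<..}"
      then have "hausdorff_premeasure k \<delta> (\<Union>i. A i) \<le> (\<Sum>i. hausdorff_premeasure k \<delta> (A i))"
        using pre[of \<delta>] \<open>disjoint_family A\<close> by (auto simp: countably_subadditive_def)
      also have "\<dots> \<le> (\<Sum>i. hausdorff_outer_measure k (A i))"
        unfolding hausdorff_outer_measure_def using d by (intro suminf_le SUP_upper) auto
      finally show "hausdorff_premeasure k \<delta> (\<Union>i. A i) \<le> (\<Sum>i. hausdorff_outer_measure k (A i))" .
    qed
  qed
qed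

lemma outer_measure_space_subadditive:
  assumes "outer_measure_space UNIV f"
  shows "f (A \<union> B) \<le> f A + f B"
proof -
  interpret sigma_algebra UNIV UNIV
    using sigma_algebra_Pow[of UNIV] by simp
  have "subadditive UNIV f"
    using assms countably_subadditive_subadditive unfolding outer_measure_space_def by blast
  then have "f (A \<union> (B - A)) \<le> f A + f (B - A)"
    unfolding subadditive_def by blast
  also have "f (B - A) \<le> f B"
    using assms by (auto simp: outer_measure_space_def increasing_def)
  finally show ?thesis by (simp add: add_left_mono)
qed

text \<open>\<open>countably_subadditive\<close> speaks of disjoint families only;
  \<open>disjointed\<close> together with monotonicity removes this restriction.\<close>

lemma outer_measure_space_countably_subadditive:
  fixes f :: "'a set \<Rightarrow> ennreal" and A :: "nat \<Rightarrow> 'a set"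
  assumes "outer_measure_space UNIV f"
  shows "f (\<Union>i. A i) \<le> (\<Sum>i. f (A i))"
proof -
  have "f (\<Union>i. disjointed A i) \<le> (\<Sum>i. f (disjointed A i))"
    using assms disjoint_family_disjointed[of A]
    by (simp add: outer_measure_space_def countably_subadditive_def)
  also have "\<dots> \<le> (\<Sum>i. f (A i))"
    using assms disjointed_subset[of A]
    by (intro suminf_le) (auto simp: outer_measure_space_def increasing_def)
  finally show ?thesis by (simp add: UN_disjointed_eq)
qed

text \<open>A set of diameter below \<open>d\<close> cannot meet both \<open>A\<close> and
  \<open>B\<close>. Hence every cover of the union splits into a cover of \<open>A\<close> and a
  cover of \<open>B\<close> that share no nonempty member.\<close>

lemma hausdorff_premeasure_separated:
  fixes A B :: "'a::metric_space set"
  assumes "\<delta> < d" and sep: "\<And>a b. a \<in> A \<Longrightarrow> b \<in> B \<Longrightarrow> d \<le> dist a b"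
  shows "hausdorff_premeasure k \<delta> A + hausdorff_premeasure k \<delta> B \<le> hausdorff_premeasure k \<delta> (A \<union> B)"
  unfolding hausdorff_premeasure_def[of k \<delta> "A \<union> B"]
proof (rule INF_greatest)
  fix U :: "nat \<Rightarrow> 'a set"
  assume "U \<in> {U. A \<union> B \<subseteq> (\<Union>i. U i) \<and> (\<forall>i. bounded (U i) \<and> diameter (U i) \<le> \<delta>)}"
  then have cov: "A \<union> B \<subseteq> (\<Union>i. U i)" and bd: "\<And>i. bounded (U i)" and dm: "\<And>i. diameter (U i) \<le> \<delta>"
    by auto
  \<comment> \<open>Discarded members become empty rather than being removed, which keeps the
    indexing; the empty set has weight 0 even for \<open>k = 0\<close>.\<close>
  define V where "V C i = (if U i \<inter> C = {} then {} else U i)" for C i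
  have "0 \<le> \<delta>" using diameter_ge_0[OF bd] dm by (rule order_trans)
  have pre: "hausdorff_premeasure k \<delta> C \<le> (\<Sum>i. hausdorff_weight k (V C i))" if "C \<subseteq> A \<union> B" for C
    unfolding hausdorff_premeasure_def
  proof (rule INF_lower, safe)
    show "x \<in> (\<Union>i. V C i)" if "x \<in> C" for x
      using that \<open>C \<subseteq> A \<union> B\<close> cov by (force simp: V_def)
  qed (use bd dm \<open>0 \<le> \<delta>\<close> in \<open>auto simp: V_def\<close>)
  have one: "V A i = {} \<or> V B i = {}" for i
  proof (rule ccontr)
    assume "\<not> ?thesis"
    then obtain a b where "a \<in> U i" "a \<in> A" "b \<in> U i" "b \<in> B"
      by (auto simp: V_def split: if_splits)
    then show False
      using sep[of a b] diameter_bounded_bound[OF bd[of i], of a b] dm[of i] \<open>\<delta> < d\<close> by auto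
  qed
  have "hausdorff_premeasure k \<delta> A + hausdorff_premeasure k \<delta> B
      \<le> (\<Sum>i. hausdorff_weight k (V A i)) + (\<Sum>i. hausdorff_weight k (V B i))"
    by (intro add_mono pre) auto
  also have "\<dots> = (\<Sum>i. hausdorff_weight k (V A i) + hausdorff_weight k (V B i))"
    by (intro suminf_add) auto
  also have "\<dots> \<le> (\<Sum>i. hausdorff_weight k (U i))"
  proof (intro suminf_le allI)
    show "hausdorff_weight k (V A i) + hausdorff_weight k (V B i) \<le> hausdorff_weight k (U i)" for i
      using one[of i] by (auto simp: V_def hausdorff_weight_def split: if_splits)
  qed auto
  finally show "hausdorff_premeasure k \<delta> A + hausdorff_premeasure k \<delta> B \<le> (\<Sum>i. hausdorff_weight k (U i))" .
qed

lemma hausdorff_outer_measure_separated: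
  fixes A B :: "'a::metric_space set"
  assumes "0 < d" and sep: "\<And>a b. a \<in> A \<Longrightarrow> b \<in> B \<Longrightarrow> d \<le> dist a b"
  shows "hausdorff_outer_measure k A + hausdorff_outer_measure k B \<le> hausdorff_outer_measure k (A \<union> B)"
proof -
  have le: "hausdorff_premeasure k \<delta> A + hausdorff_premeasure k \<epsilon> B \<le> hausdorff_outer_measure k (A \<union> B)"
    if "\<delta> > 0" "\<epsilon> > 0" for \<delta> \<epsilon> :: real
  proof -
    \<comment> \<open>A common scale below both given ones and below \<open>d\<close>. Refining only
      raises the premeasures, so the two suprema can be taken independently.\<close>
    define \<eta> where "\<eta> = min (min \<delta> \<epsilon>) (d / 2)"
    have eta: "\<eta> > 0" "\<eta> < d" "\<eta> \<le> \<delta>" "\<eta> \<le> \<epsilon>"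
      using that \<open>0 < d\<close> by (auto simp: \<eta>_def)
    have "hausdorff_premeasure k \<delta> A + hausdorff_premeasure k \<epsilon> B
        \<le> hausdorff_premeasure k \<eta> A + hausdorff_premeasure k \<eta> B"
      using eta by (intro add_mono hausdorff_premeasure_antimono)
    also have "\<dots> \<le> hausdorff_premeasure k \<eta> (A \<union> B)"
      using eta sep by (intro hausdorff_premeasure_separated)
    also have "\<dots> \<le> hausdorff_outer_measure k (A \<union> B)"
      unfolding hausdorff_outer_measure_def using eta by (intro SUP_upper) auto
    finally show ?thesis .
  qed
  have ne: "{0<..} \<noteq> ({} :: real set)" using zero_less_one by blast
  have "hausdorff_outer_measure k A + hausdorff_premeasure k \<epsilon> B \<le> hausdorff_outer_measure k (A \<union> B)"
    if "\<epsilon> > 0" for \<epsilon> :: real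
    unfolding hausdorff_outer_measure_def[of k A]
    by (subst ennreal_SUP_add_left[symmetric]) (use ne le that in \<open>auto intro: SUP_least\<close>)
  then show ?thesis
    by (subst (2) hausdorff_outer_measure_def, subst ennreal_SUP_add_right) (use ne in \<open>auto intro: SUP_least\<close>)
qed

text \<open>
  The distance shells of \<open>A\<close> around the closed set \<open>C\<close>, taken with every second index, are
  positively separated. Hence their measures are summable, and the tails tend to 0.
\<close>

lemma metric_outer_measure_closed:
  fixes f :: "'a::metric_space set \<Rightarrow> ennreal"
  assumes om: "outer_measure_space UNIV f"
    and sep: "\<And>A B d. 0 < d \<Longrightarrow> (\<And>a b. a \<in> A \<Longrightarrow> b \<in> B \<Longrightarrow> d \<le> dist a b) \<Longrightarrow> f A + f B \<le> f (A \<union> B)"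
    and "closed C"
  shows "f (A \<inter> C) + f (A - C) \<le> f A"
\<comment> \<open>For empty \<open>C\<close>, \<open>infdist\<close> is 0 by convention and the
  shells would say nothing; for infinite \<open>f A\<close> there is nothing to prove.\<close>
proof (cases "C = {} \<or> f A = \<infinity>")
  case True
  moreover have "f {} = 0" using om by (simp add: outer_measure_space_def positive_def)
  ultimately show ?thesis by auto
next
  case False
  then have "C \<noteq> {}" and fin: "f A < \<infinity>" by (auto simp: less_top)
  have mono: "f X \<le> f Y" if "X \<subseteq> Y" for X Y
    using om that by (auto simp: outer_measure_space_def increasing_def)
  have "f {} = 0" using om by (simp add: outer_measure_space_def positive_def)
  define E where "E i = {x \<in> A. infdist x C \<ge> 1 / real (Suc i)}" for i
  define R where "R i = E (Suc i) - E i" for i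
  have Einc: "E i \<subseteq> E j" if "i \<le> j" for i j
  proof -
    have "1 / real (Suc j) \<le> 1 / real (Suc i)" using that by (simp add: frac_le)
    then show ?thesis by (auto simp: E_def intro: order_trans)
  qed
  have EA: "E i \<subseteq> A" for i by (auto simp: E_def)
  have shell: "1 / real (Suc i) - 1 / real (Suc (Suc i)) \<le> dist x y"
    if "x \<in> E i" "y \<in> A - E (Suc i)" for i x y
  proof -
    have "infdist x C \<le> infdist y C + dist x y" by (rule infdist_triangle)
    then show ?thesis using that by (auto simp: E_def not_le)
  qed
  have gap: "0 < 1 / real (Suc i) - 1 / real (Suc (Suc i))" for i
    by (simp add: frac_less2)
  \<comment> \<open>The offset \<open>c\<close> is 0 for the shells of odd index and 1 for those of
    even index. \<open>R (2 * n + c + 1)\<close> lies outside \<open>E (2 * n + c + 1)\<close>,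
    hence at positive distance from \<open>E (2 * n + c)\<close>.\<close>
  have add2: "(\<Sum>j<n. f (R (2 * j + c + 1))) \<le> f (E (2 * n + c))" for n c
  proof (induction n)
    case (Suc n)
    have "(\<Sum>j<Suc n. f (R (2 * j + c + 1))) \<le> f (E (2 * n + c)) + f (R (2 * n + c + 1))"
      using Suc by (simp add: add_right_mono)
    also have "\<dots> \<le> f (E (2 * n + c) \<union> R (2 * n + c + 1))"
      using EA by (intro sep[OF gap[of "2 * n + c"]] shell) (auto simp: R_def)
    also have "\<dots> \<le> f (E (2 * Suc n + c))"
      using Einc[of "2 * n + c" "2 * Suc n + c"] by (intro mono) (auto simp: R_def)
    finally show ?case .
  qed auto
  have split: "(\<Sum>i<2 * n. f (R (Suc i))) = (\<Sum>j<n. f (R (2 * j + 0 + 1))) + (\<Sum>j<n. f (R (2 * j + 1 + 1)))" for n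
    by (induction n) (auto simp: ac_simps)
  have "(\<Sum>i<n. f (R (Suc i))) \<le> f A + f A" for n
  proof -
    have "(\<Sum>i<n. f (R (Suc i))) \<le> (\<Sum>i<2 * n. f (R (Suc i)))"
      by (intro sum_mono2) auto
    also have "\<dots> \<le> f A + f A"
      unfolding split by (intro add_mono order_trans[OF add2] mono EA)
    finally show ?thesis .
  qed
  then have "(\<Sum>i. f (R (Suc i))) \<le> f A + f A"
    by (intro suminf_le_const) auto
  then have sumfin: "(\<Sum>i. f (R (Suc i))) < \<infinity>"
    using fin by (auto simp: less_top[symmetric] top_unique)
  define g where "g i = enn2real (f (R (Suc i)))" for i
  have g_nonneg: "0 \<le> g i" for i by (simp add: g_def)
  have g: "f (R (Suc i)) = ennreal (g i)" for i
  proof -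
    have "f (R (Suc i)) \<le> f A" by (intro mono) (auto simp: R_def E_def)
    then have "f (R (Suc i)) < top" using fin by (metis infinity_ennreal_def le_less_trans)
    then show ?thesis by (simp add: g_def)
  qed
  have "summable g"
    using sumfin unfolding g by (intro summable_suminf_not_top) (auto simp: g_nonneg)
  show ?thesis
  proof (rule ennreal_le_epsilon)
    fix e :: real assume "0 < e"
    obtain N where N: "\<And>n. n \<ge> N \<Longrightarrow> norm (\<Sum>i. g (i + n)) < e"
      using suminf_exist_split[OF \<open>0 < e\<close> \<open>summable g\<close>] by blast
    have "A - C \<subseteq> E (Suc N) \<union> (\<Union>i. R (Suc (i + N)))"
    proof
      fix x assume x: "x \<in> A - C"
      have "infdist x C > 0"
        using x \<open>closed C\<close> \<open>C \<noteq> {}\<close> by (simp add: infdist_pos_not_in_closed)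
      then obtain j where "inverse (real (Suc j)) < infdist x C"
        using reals_Archimedean by blast
      then have "x \<in> E j" using x by (auto simp: E_def inverse_eq_divide)
      define l where "l = (LEAST j. x \<in> E j)"
      have l: "x \<in> E l" "\<And>j. j < l \<Longrightarrow> x \<notin> E j"
        using LeastI[of "\<lambda>j. x \<in> E j", OF \<open>x \<in> E j\<close>] not_less_Least unfolding l_def by auto
      show "x \<in> E (Suc N) \<union> (\<Union>i. R (Suc (i + N)))"
      proof (cases "l \<le> Suc N")
        case True then show ?thesis using l Einc by blast
      next
        case False
        \<comment> \<open>The first \<open>E\<close> containing \<open>x\<close> has index
          \<open>l\<close>, so \<open>x\<close> lies in the shell of index \<open>l - 1\<close>. As
          \<open>l\<close> is at least \<open>N + 2\<close>, the truncated subtraction is exact and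
          the index displayed is \<open>l - 1\<close>.\<close>
        then have "x \<in> R (Suc ((l - 2 - N) + N))"
          using l by (auto simp: R_def Suc_diff_Suc numeral_2_eq_2)
        then show ?thesis by blast
      qed
    qed
    then have "f (A - C) \<le> f (E (Suc N) \<union> (\<Union>i. R (Suc (i + N))))" by (rule mono)
    also have "\<dots> \<le> f (E (Suc N)) + f (\<Union>i. R (Suc (i + N)))"
      by (rule outer_measure_space_subadditive[OF om])
    also have "\<dots> \<le> f (E (Suc N)) + (\<Sum>i. f (R (Suc (i + N))))"
      by (intro add_left_mono outer_measure_space_countably_subadditive[OF om])
    also have "(\<Sum>i. f (R (Suc (i + N)))) = ennreal (\<Sum>i. g (i + N))"
      unfolding g using \<open>summable g\<close> by (intro suminf_ennreal2) (auto simp: summable_iff_shift g_nonneg)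
    also have "\<dots> \<le> ennreal e" using N[of N] by (intro ennreal_leI) auto
    finally have "f (A \<inter> C) + f (A - C) \<le> f (A \<inter> C) + (f (E (Suc N)) + e)"
      by (simp add: add_left_mono)
    also have "\<dots> = f (A \<inter> C) + f (E (Suc N)) + e" by (simp add: add.assoc)
    also have "f (A \<inter> C) + f (E (Suc N)) \<le> f (A \<inter> C \<union> E (Suc N))"
    proof (rule sep)
      show "1 / real (Suc (Suc N)) \<le> dist a b" if "a \<in> A \<inter> C" "b \<in> E (Suc N)" for a b
        using that infdist_le[of a C b] by (simp add: E_def dist_commute)
    qed simp
    also have "\<dots> \<le> f A" by (intro mono) (auto simp: E_def)
    finally show "f (A \<inter> C) + f (A - C) \<le> f A + e" by (simp add: add_right_mono)
  qed
qed

lemma sets_hausdorff_measure [simp, measurable_cong]: "sets (hausdorff_measure k) = sets borel"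
  by (simp add: hausdorff_measure_def sets.sigma_sets_eq[of borel, unfolded space_borel])

lemma space_hausdorff_measure [simp]: "space (hausdorff_measure k) = UNIV"
  by (simp add: hausdorff_measure_def)

text \<open>Caratheodory's criterion: the sets that split every set additively form a
  \<sigma>-algebra on which the outer measure is countably additive. It contains the closed sets by
  the metric property, hence all Borel sets.\<close>

lemma emeasure_hausdorff_measure:
  fixes A :: "'a::metric_space set"
  assumes "A \<in> sets borel"
  shows "emeasure (hausdorff_measure k) A = hausdorff_outer_measure k A"
proof -
  let ?f = "hausdorff_outer_measure k :: 'a set \<Rightarrow> ennreal"
  interpret sigma_algebra "UNIV :: 'a set" UNIV
    using sigma_algebra_Pow[of UNIV] by simp
  have ms: "measure_space UNIV (lambda_system UNIV UNIV ?f) ?f"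
    by (rule caratheodory_lemma[OF hausdorff_outer_measure_space])
  then have sa: "sigma_algebra UNIV (lambda_system UNIV UNIV ?f)"
    by (simp add: measure_space_def)
  have "C \<in> lambda_system UNIV UNIV ?f" if "closed C" for C
    unfolding lambda_system_eq
  proof (intro CollectI conjI ballI antisym)
    fix X :: "'a set"
    show "?f (X \<inter> C) + ?f (X - C) \<le> ?f X"
      by (rule metric_outer_measure_closed[OF hausdorff_outer_measure_space
            hausdorff_outer_measure_separated that])
    have "?f X = ?f ((X \<inter> C) \<union> (X - C))" by (simp only: Int_Diff_Un)
    also have "\<dots> \<le> ?f (X \<inter> C) + ?f (X - C)"
      by (rule outer_measure_space_subadditive[OF hausdorff_outer_measure_space])
    finally show "?f X \<le> ?f (X \<inter> C) + ?f (X - C)" .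
  qed simp
  then have "sigma_sets UNIV (Collect closed) \<subseteq> lambda_system UNIV UNIV ?f"
    by (intro sigma_algebra.sigma_sets_subset[OF sa] subsetI) simp
  then have sub: "sets (borel :: 'a measure) \<subseteq> lambda_system UNIV UNIV ?f"
    by (subst borel_eq_closed) simp
  show ?thesis
  proof (rule emeasure_measure_of[OF hausdorff_measure_def])
    show "positive (sets (hausdorff_measure k)) ?f"
      using hausdorff_outer_measure_space[of k, where 'a = 'a]
      by (simp add: outer_measure_space_def positive_def)
    have "countably_additive (lambda_system UNIV UNIV ?f) ?f"
      using ms by (simp add: measure_space_def)
    then show "countably_additive (sets (hausdorff_measure k)) ?f"
      unfolding countably_additive_def sets_hausdorff_measure
      by (meson sub subset_trans subsetD)
    show "A \<in> sets (hausdorff_measure k)"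
      using assms by simp
  qed (simp add: sets.space_closed[of borel, unfolded space_borel])
qed

subsection \<open>Hausdorff measure of the unit sphere\<close>

text \<open>The Householder reflection in the hyperplane orthogonal to \<open>w\<close>. For
  \<open>w = 0\<close> division by zero makes it the identity, so \<open>reflect_swap\<close> also
  covers equal vectors.\<close>

definition reflect :: "'a::real_inner \<Rightarrow> 'a \<Rightarrow> 'a" where
  "reflect w x = x - (2 * (w \<bullet> x) / (w \<bullet> w)) *\<^sub>R w"

lemma reflect_reflect [simp]: "reflect w (reflect w x) = x"
  by (cases "w = 0") (simp_all add: reflect_def algebra_simps)

lemma inner_reflect: "x \<bullet> reflect w y = reflect w x \<bullet> y"
  by (simp add: reflect_def inner_diff_left inner_diff_right inner_commute)

lemma linear_reflect: "linear (reflect w)"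
  by (rule linearI) (simp_all add: reflect_def algebra_simps add_divide_distrib)

lemma norm_reflect [simp]: "norm (reflect w x) = norm x"
  by (simp add: norm_eq_sqrt_inner inner_reflect)

lemma dist_reflect: "dist (reflect w x) (reflect w y) = dist x y"
  by (metis dist_norm linear_diff linear_reflect norm_reflect)

text \<open>Equal norms give \<open>(a - b) \<bullet> (a - b) = 2 * ((a - b) \<bullet> a)\<close>,
  so the coefficient of \<open>a - b\<close> in the reflection is exactly 1.\<close>

lemma reflect_swap:
  assumes "norm a = norm b"
  shows "reflect (a - b) a = b"
proof (cases "a = b")
  case False
  have "a \<bullet> a = b \<bullet> b" using assms by (simp add: dot_square_norm)
  then have "(a - b) \<bullet> (a - b) = 2 * ((a - b) \<bullet> a)"
    by (simp add: inner_diff_left inner_diff_right inner_commute)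
  moreover have "(a - b) \<bullet> (a - b) \<noteq> 0" using False by simp
  ultimately have "2 * ((a - b) \<bullet> a) / ((a - b) \<bullet> (a - b)) = 1" by simp
  then show ?thesis unfolding reflect_def by (simp only:) simp
qed (simp add: reflect_def)

lemma reflect_image_eq_vimage: "reflect w ` S = reflect w -` S"
proof (intro set_eqI iffI)
  fix x assume "x \<in> reflect w -` S"
  then have "reflect w (reflect w x) \<in> reflect w ` S" by blast
  then show "x \<in> reflect w ` S" by simp
qed auto

text \<open>The images of a cover are a cover of the image with the same diameters. For a
  reflection, applying this twice gives equality.\<close>

lemma hausdorff_outer_measure_isometry_le:
  fixes f :: "'a::metric_space \<Rightarrow> 'b::metric_space"
  assumes iso: "\<And>x y. dist (f x) (f y) = dist x y"
  shows "hausdorff_outer_measure k (f ` S) \<le> hausdorff_outer_measure k S"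
  unfolding hausdorff_outer_measure_def
proof (intro SUP_mono bexI)
  have dm: "diameter (f ` U) = diameter U" for U
  proof -
    have "(\<lambda>(x, y). dist x y) ` (f ` U \<times> f ` U) = (\<lambda>(x, y). dist x y) ` (U \<times> U)"
      using iso by (force simp: image_iff)
    then show ?thesis by (simp add: diameter_def)
  qed
  have bd: "bounded (f ` U)" if "bounded U" for U
    using that iso unfolding bounded_two_points by auto
  show "hausdorff_premeasure k \<delta> (f ` S) \<le> hausdorff_premeasure k \<delta> S" for \<delta>
    unfolding hausdorff_premeasure_def
  proof (rule INF_mono)
    fix U :: "nat \<Rightarrow> 'a set"
    assume "U \<in> {U. S \<subseteq> (\<Union>i. U i) \<and> (\<forall>i. bounded (U i) \<and> diameter (U i) \<le> \<delta>)}"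
    moreover from this have "f ` S \<subseteq> (\<Union>i. f ` U i)" by blast
    ultimately have "(\<lambda>i. f ` U i) \<in> {U. f ` S \<subseteq> (\<Union>i. U i) \<and> (\<forall>i. bounded (U i) \<and> diameter (U i) \<le> \<delta>)}"
      by (auto simp: bd dm)
    then show "\<exists>V \<in> {U. f ` S \<subseteq> (\<Union>i. U i) \<and> (\<forall>i. bounded (U i) \<and> diameter (U i) \<le> \<delta>)}.
        (\<Sum>i. hausdorff_weight k (V i)) \<le> (\<Sum>i. hausdorff_weight k (U i))"
      by (rule bexI[rotated]) (simp add: hausdorff_weight_def dm cong: if_cong)
  qed
qed

lemma hausdorff_outer_measure_reflect:
  "hausdorff_outer_measure k (reflect w ` S) = hausdorff_outer_measure k S"
proof (rule antisym)
  show "hausdorff_outer_measure k (reflect w ` S) \<le> hausdorff_outer_measure k S"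
    by (intro hausdorff_outer_measure_isometry_le dist_reflect)
  have "hausdorff_outer_measure k (reflect w ` reflect w ` S) \<le> hausdorff_outer_measure k (reflect w ` S)"
    by (intro hausdorff_outer_measure_isometry_le dist_reflect)
  then show "hausdorff_outer_measure k S \<le> hausdorff_outer_measure k (reflect w ` S)"
    by (simp add: image_image)
qed

section \<open>Finiteness of the surface measure of the sphere\<close>

text \<open>A crude mean value estimate. The cap 2 suffices for its use with the radii
  \<open>1 + \<delta> / 2\<close> and \<open>1 - \<delta> / 2\<close>, where
  \<open>\<delta> \<le> 1\<close>.\<close>

lemma diff_power_le:
  fixes a b :: real
  assumes "0 \<le> b" "b \<le> a" "a \<le> 2"
  shows "a ^ n - b ^ n \<le> real n * (a - b) * 2 ^ n"
proof (induction n)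
  case (Suc n)
  have "a ^ Suc n - b ^ Suc n = a * (a ^ n - b ^ n) + (a - b) * b ^ n"
    by (simp add: algebra_simps)
  also have "\<dots> \<le> 2 * (real n * (a - b) * 2 ^ n) + (a - b) * 2 ^ n"
    using Suc assms power_mono[of b a n] by (intro add_mono mult_mono power_mono) auto
  also have "\<dots> \<le> real (Suc n) * (a - b) * 2 ^ Suc n"
    using assms by (simp add: algebra_simps mult_left_mono)
  finally show ?case .
qed simp

text \<open>
  The disjoint balls of radius \<open>\<delta>/2\<close> about a \<open>\<delta>\<close>-separated subset of the sphere lie in a shell
  of thickness \<open>\<delta>\<close>; comparing volumes bounds the number of points.
\<close>

lemma card_separated_subset_sphere:
  fixes T :: "'a::euclidean_space set"
  assumes "finite T" "T \<subseteq> sphere 0 1" "0 < \<delta>" "\<delta> \<le> 1"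
    and sep: "\<And>s t. s \<in> T \<Longrightarrow> t \<in> T \<Longrightarrow> s \<noteq> t \<Longrightarrow> \<delta> \<le> dist s t"
  shows "real (card T) * \<delta> ^ (DIM('a) - 1) \<le> real DIM('a) * 4 ^ DIM('a)"
proof -
  let ?n = "DIM('a)" and ?w = "unit_ball_vol (real DIM('a))"
  have meas: "ball x r \<in> lmeasurable" "cball x r \<in> lmeasurable" for x :: 'a and r
    by auto
  have "real (card T) * (?w * (\<delta> / 2) ^ ?n) = (\<Sum>t\<in>T. measure lebesgue (ball t (\<delta> / 2)))"
    using assms by (simp add: content_ball)
  also have "\<dots> = measure lebesgue (\<Union>t\<in>T. ball t (\<delta> / 2))"
  proof (rule measure_UNION'[symmetric])
    show "pairwise (\<lambda>s t. disjnt (ball s (\<delta> / 2)) (ball t (\<delta> / 2))) T"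
    proof (intro pairwiseI)
      fix s t assume "s \<in> T" "t \<in> T" "s \<noteq> t"
      then have "\<delta> \<le> dist s t" by (rule sep)
      then show "disjnt (ball s (\<delta> / 2)) (ball t (\<delta> / 2))"
        using dist_triangle_half_r[of _ s \<delta> t] by (fastforce simp: disjnt_def dist_commute)
    qed
  qed (use assms(1) meas in auto)
  also have "\<dots> \<le> measure lebesgue (cball (0::'a) (1 + \<delta> / 2) - ball 0 (1 - \<delta> / 2))"
  proof (rule measure_mono_fmeasurable)
    show "(\<Union>t\<in>T. ball t (\<delta> / 2)) \<subseteq> cball 0 (1 + \<delta> / 2) - ball 0 (1 - \<delta> / 2)"
    proof (intro UN_least subsetI)
      fix t x assume "t \<in> T" "x \<in> ball t (\<delta> / 2)"
      then have "norm t = 1" "norm (t - x) < \<delta> / 2" using assms by (auto simp: dist_norm)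
      then show "x \<in> cball 0 (1 + \<delta> / 2) - ball 0 (1 - \<delta> / 2)"
        using norm_triangle_ineq2[of x t] norm_triangle_ineq2[of t x] by (simp add: norm_minus_commute)
    qed
  qed (use meas in \<open>auto intro!: fmeasurable_Diff sets.finite_UN assms(1)\<close>)
  also have "\<dots> = measure lebesgue (cball (0::'a) (1 + \<delta> / 2)) - measure lebesgue (ball (0::'a) (1 - \<delta> / 2))"
    using assms meas by (intro measurable_measure_Diff) auto
  also have "\<dots> = ?w * ((1 + \<delta> / 2) ^ ?n - (1 - \<delta> / 2) ^ ?n)"
    using assms by (simp add: content_ball content_cball right_diff_distrib)
  also have "\<dots> \<le> ?w * (real ?n * ((1 + \<delta> / 2) - (1 - \<delta> / 2)) * 2 ^ ?n)"
    using assms by (intro mult_left_mono diff_power_le) auto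
  finally have "real (card T) * (\<delta> / 2) ^ ?n \<le> real ?n * \<delta> * 2 ^ ?n"
    by (simp add: mult.left_commute[of _ ?w])
  \<comment> \<open>One factor \<open>2 ^ n\<close> comes from the halved radius of the balls, the
    other from \<open>diff_power_le\<close>; together they give \<open>4 ^ n\<close>.\<close>
  then have "real (card T) * \<delta> ^ ?n \<le> real ?n * \<delta> * (2 ^ ?n * 2 ^ ?n)"
    by (simp add: power_divide field_simps)
  also have "(2 ^ ?n * 2 ^ ?n :: real) = 4 ^ ?n"
    by (simp flip: power_mult_distrib)
  finally have "real (card T) * (\<delta> ^ (?n - 1) * \<delta>) \<le> real ?n * 4 ^ ?n * \<delta>"
    using power_minus_mult[of ?n \<delta>] by (simp add: ac_simps)
  then show ?thesis
    using \<open>0 < \<delta>\<close> by (simp flip: mult.assoc)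
qed

text \<open>A separated subset of maximal cardinality exists by the preceding bound, and it is a
  net: an uncovered point of the sphere could be added to it.\<close>

lemma sphere_net:
  assumes "0 < \<delta>" "\<delta> \<le> 1"
  obtains T :: "'a::euclidean_space set" where "finite T"
    "real (card T) * \<delta> ^ (DIM('a) - 1) \<le> real DIM('a) * 4 ^ DIM('a)"
    "sphere 0 1 \<subseteq> (\<Union>t\<in>T. cball t \<delta>)"
proof -
  define P where "P T \<longleftrightarrow> finite T \<and> T \<subseteq> sphere (0::'a) 1 \<and>
    (\<forall>s\<in>T. \<forall>t\<in>T. s \<noteq> t \<longrightarrow> \<delta> \<le> dist s t)" for T
  have bound: "real (card T) * \<delta> ^ (DIM('a) - 1) \<le> real DIM('a) * 4 ^ DIM('a)" if "P T" for T
    using that assms by (intro card_separated_subset_sphere) (auto simp: P_def)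
  have "card T < nat \<lceil>real DIM('a) * 4 ^ DIM('a) / \<delta> ^ (DIM('a) - 1)\<rceil> + 1" if "P T" for T
  proof -
    have "real (card T) \<le> real DIM('a) * 4 ^ DIM('a) / \<delta> ^ (DIM('a) - 1)"
      using bound[OF that] assms by (simp add: pos_le_divide_eq)
    then show ?thesis by linarith
  qed
  moreover have "P {}" by (simp add: P_def)
  ultimately obtain T where T: "P T" and max: "\<And>T'. P T' \<Longrightarrow> card T' \<le> card T"
    using ex_has_greatest_nat[of P "{}" card] by blast
  have "sphere 0 1 \<subseteq> (\<Union>t\<in>T. cball t \<delta>)"
  proof
    fix x :: 'a assume x: "x \<in> sphere 0 1"
    show "x \<in> (\<Union>t\<in>T. cball t \<delta>)"
    proof (rule ccontr)
      assume far: "x \<notin> (\<Union>t\<in>T. cball t \<delta>)"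
      then have "P (insert x T)" using T x by (auto simp: P_def dist_commute)
      moreover have "x \<notin> T" using far assms by auto
      ultimately show False using max[of "insert x T"] T by (simp add: P_def)
    qed
  qed
  then show ?thesis using that T bound by (auto simp: P_def)
qed

lemma hausdorff_premeasure_finite_cover:
  assumes "finite T" "S \<subseteq> (\<Union>t\<in>T. V t)" "\<And>t. t \<in> T \<Longrightarrow> bounded (V t)"
    "\<And>t. t \<in> T \<Longrightarrow> diameter (V t) \<le> \<delta>" "0 \<le> \<delta>"
  shows "hausdorff_premeasure k \<delta> S \<le> (\<Sum>t\<in>T. hausdorff_weight k (V t))"
proof -
  obtain h where h: "bij_betw h {..<card T} T"
    using ex_bij_betw_nat_finite[OF \<open>finite T\<close>] by (auto simp: atLeast0LessThan)
  define U where "U i = (if i < card T then V (h i) else {})" for i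
  have "hausdorff_premeasure k \<delta> S \<le> (\<Sum>i. hausdorff_weight k (U i))"
    unfolding hausdorff_premeasure_def
  proof (intro INF_lower CollectI conjI allI)
    show "S \<subseteq> (\<Union>i. U i)"
    proof
      fix x assume "x \<in> S"
      then obtain t where "t \<in> T" "x \<in> V t" using assms(2) by blast
      have "t \<in> h ` {..<card T}"
        using \<open>t \<in> T\<close> by (simp add: bij_betw_imp_surj_on[OF h])
      then obtain i where "i < card T" "t = h i" by auto
      then have "x \<in> U i" using \<open>x \<in> V t\<close> by (simp add: U_def)
      then show "x \<in> (\<Union>i. U i)" by blast
    qed
    show "bounded (U i)" "diameter (U i) \<le> \<delta>" for i
      using assms(3-5) bij_betwE[OF h] by (simp_all add: U_def)
  qed
  also have "\<dots> = (\<Sum>i<card T. hausdorff_weight k (U i))"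
    by (intro suminf_finite) (simp_all add: U_def hausdorff_weight_def)
  also have "\<dots> = (\<Sum>i<card T. hausdorff_weight k (V (h i)))"
    by (simp add: U_def)
  also have "\<dots> = (\<Sum>t\<in>T. hausdorff_weight k (V t))"
    by (rule sum.reindex_bij_betw[OF h])
  finally show ?thesis .
qed

text \<open>A net of radius \<open>\<eta>\<close> has at most a constant times \<open>\<eta>\<close>
  to the power \<open>1 - n\<close> points, and a ball of that radius has weight proportional to
  \<open>\<eta>\<close> to the power \<open>n - 1\<close>. The powers cancel, so the bound is the
  same at every scale.\<close>

lemma hausdorff_outer_measure_sphere_finite:
  "hausdorff_outer_measure (DIM('a) - 1) (sphere (0::'a::euclidean_space) 1) < \<infinity>"
proof -
  let ?k = "DIM('a) - 1"
  define C where "C = unit_ball_vol (real ?k) * (real DIM('a) * 4 ^ DIM('a))"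
  have "hausdorff_premeasure ?k \<delta> (sphere (0::'a) 1) \<le> ennreal C" if "0 < \<delta>" for \<delta>
  proof -
    define \<eta> where "\<eta> = min 1 (\<delta> / 2)"
    have eta: "0 < \<eta>" "\<eta> \<le> 1" "2 * \<eta> \<le> \<delta>" using that by (auto simp: \<eta>_def)
    obtain T :: "'a set" where T: "finite T" "real (card T) * \<eta> ^ ?k \<le> real DIM('a) * 4 ^ DIM('a)"
      "sphere 0 1 \<subseteq> (\<Union>t\<in>T. cball t \<eta>)"
      using sphere_net[OF eta(1,2)] by blast
    have "hausdorff_premeasure ?k \<delta> (sphere (0::'a) 1) \<le> (\<Sum>t\<in>T. hausdorff_weight ?k (cball t \<eta>))"
      using T eta that by (intro hausdorff_premeasure_finite_cover) (auto simp: diameter_cball)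
    also have "\<dots> = ennreal (\<Sum>t\<in>T. unit_ball_vol (real ?k) * \<eta> ^ ?k)"
      using eta by (subst sum_ennreal[symmetric]) (auto simp: hausdorff_weight_def diameter_cball)
    also have "\<dots> \<le> ennreal C"
      using T(2) mult_left_mono[OF T(2), of "unit_ball_vol (real ?k)"]
      by (intro ennreal_leI) (simp add: C_def ac_simps)
    finally show ?thesis .
  qed
  then have "hausdorff_outer_measure ?k (sphere (0::'a) 1) \<le> ennreal C"
    unfolding hausdorff_outer_measure_def by (auto intro: SUP_least)
  then show ?thesis by (simp add: le_less_trans)
qed

section \<open>Positivity of the surface measure of the sphere\<close>

text \<open>The cone lies close to the segment from 0 to \<open>u\<close>. About
  \<open>1 / d\<close> balls of radius \<open>2 * d\<close> centred on the segment cover it, each of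
  volume of order \<open>d ^ n\<close>.\<close>

lemma emeasure_cone_cball_le:
  fixes u :: "'a::euclidean_space"
  assumes "norm u = 1" "0 \<le> d" "d \<le> 1" "DIM('a) \<ge> 2"
  shows "emeasure lborel ((\<lambda>(t, x). t *\<^sub>R x) ` ({0..1} \<times> cball u d))
    \<le> ennreal (3 * 2 ^ DIM('a) * unit_ball_vol (real DIM('a)) * d ^ (DIM('a) - 1))"
proof -
  let ?C = "(\<lambda>(t, x). t *\<^sub>R x) ` ({0..1} \<times> cball u d)"
  let ?K = "3 * 2 ^ DIM('a) * unit_ball_vol (real DIM('a))"
  \<comment> \<open>A step length \<open>e \<ge> d\<close> is allowed because steps of length
    \<open>d\<close> make no sense for \<open>d = 0\<close>. In that case \<open>e\<close> tends to
    0, and \<open>n \<ge> 2\<close> makes the bound tend to 0 as well.\<close>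
  have le: "emeasure lborel ?C \<le> ennreal (?K * e ^ (DIM('a) - 1))" if e: "d \<le> e" "0 < e" "e \<le> 1" for e
  proof -
    define N where "N = nat \<lfloor>1 / e\<rfloor>"
    have "?C \<subseteq> (\<Union>j\<in>{..N}. cball ((real j * e) *\<^sub>R u) (2 * e))"
    proof clarify
      fix t :: real and x assume t: "t \<in> {0..1}" and x: "x \<in> cball u d"
      define j where "j = nat \<lfloor>t / e\<rfloor>"
      have "t / e \<le> 1 / e" using t e by (simp add: divide_right_mono)
      then have "j \<le> N" unfolding j_def N_def by (intro nat_mono floor_mono)
      have "real j \<le> t / e" "t / e < real j + 1"
        using t e unfolding j_def by (auto simp: of_nat_nat)
      then have "\<bar>real j * e - t\<bar> \<le> e" using e by (auto simp: field_simps)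
      have "norm ((real j * e) *\<^sub>R u - t *\<^sub>R x) = norm ((real j * e - t) *\<^sub>R u + t *\<^sub>R (u - x))"
        by (simp add: algebra_simps)
      also have "\<dots> \<le> \<bar>real j * e - t\<bar> * norm u + \<bar>t\<bar> * norm (u - x)"
        by (rule order_trans[OF norm_triangle_ineq]) simp
      also have "\<dots> \<le> e + 1 * d"
        using assms t x \<open>\<bar>real j * e - t\<bar> \<le> e\<close> by (intro add_mono mult_mono) (auto simp: dist_norm)
      finally have "t *\<^sub>R x \<in> cball ((real j * e) *\<^sub>R u) (2 * e)"
        using e by (simp add: dist_norm)
      then show "t *\<^sub>R x \<in> (\<Union>j\<in>{..N}. cball ((real j * e) *\<^sub>R u) (2 * e))"
        using \<open>j \<le> N\<close> by blast
    qed
    then have "emeasure lborel ?C \<le> emeasure lborel (\<Union>j\<in>{..N}. cball ((real j * e) *\<^sub>R u) (2 * e))"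
      by (intro emeasure_mono) auto
    also have "\<dots> \<le> (\<Sum>j\<le>N. emeasure lborel (cball ((real j * e) *\<^sub>R u) (2 * e)))"
      by (intro emeasure_subadditive_finite) auto
    also have "\<dots> = ennreal (\<Sum>j\<le>N. unit_ball_vol (real DIM('a)) * (2 * e) ^ DIM('a))"
      using e by (subst sum_ennreal[symmetric]) (auto simp: emeasure_cball)
    also have "\<dots> \<le> ennreal (?K * e ^ (DIM('a) - 1))"
    proof (rule ennreal_leI)
      have "real N \<le> 1 / e" using e by (simp add: N_def of_nat_nat)
      then have "real N * e + e \<le> 3" using e by (simp add: field_simps)
      then have "(real N * e + e) * (2 ^ DIM('a) * unit_ball_vol (real DIM('a)) * e ^ (DIM('a) - 1))
          \<le> 3 * (2 ^ DIM('a) * unit_ball_vol (real DIM('a)) * e ^ (DIM('a) - 1))"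
        using e by (intro mult_right_mono) auto
      moreover have "e ^ DIM('a) = e ^ (DIM('a) - 1) * e"
        using power_minus_mult[of "DIM('a)" e] by simp
      ultimately show "(\<Sum>j\<le>N. unit_ball_vol (real DIM('a)) * (2 * e) ^ DIM('a)) \<le> ?K * e ^ (DIM('a) - 1)"
        by (simp add: power_mult_distrib algebra_simps)
    qed
    finally show ?thesis .
  qed
  show ?thesis
  proof (cases "d = 0")
    case True
    have "emeasure lborel ?C \<le> 0 + ennreal e" if "0 < e" for e
    proof -
      define e' where "e' = min 1 (e / ?K)"
      have K: "?K > 0" by (simp add: unit_ball_vol_pos)
      have e': "0 < e'" "e' \<le> 1" "?K * e' \<le> e"
        using that K by (auto simp: e'_def min_def field_simps)
      have "e' ^ (DIM('a) - 1) \<le> e'"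
        using e' assms(4) power_decreasing[of 1 "DIM('a) - 1" e'] by simp
      then have "?K * e' ^ (DIM('a) - 1) \<le> ?K * e'" using K by (intro mult_left_mono) auto
      then show ?thesis
      proof -
        have "emeasure lborel ?C \<le> ennreal (?K * e' ^ (DIM('a) - 1))"
          using e' True by (intro le) auto
        also have "\<dots> \<le> ennreal e"
          using e' \<open>?K * e' ^ (DIM('a) - 1) \<le> ?K * e'\<close> by (intro ennreal_leI) linarith
        finally show ?thesis by (simp only: add_0)
      qed
    qed
    then have "emeasure lborel ?C \<le> 0" by (rule ennreal_le_epsilon)
    then show ?thesis by simp
  next
    case False
    then show ?thesis using le[of d] assms by simp
  qed
qed

text \<open>
  The cones over the members of a cover of the sphere cover the unit ball, and the volume of a
  cone over a set of diameter \<open>d\<close> is of order \<open>d ^ (n - 1)\<close>.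
\<close>

lemma hausdorff_outer_measure_sphere_pos:
  assumes "DIM('a) \<ge> 2"
  shows "0 < hausdorff_outer_measure (DIM('a) - 1) (sphere (0::'a::euclidean_space) 1)"
proof -
  let ?k = "DIM('a) - 1" and ?w = "unit_ball_vol (real DIM('a))"
  \<comment> \<open>Chosen so that the cone belonging to a covering set has volume at most
    \<open>c\<close> times the weight of that set. The factor \<open>2 ^ ?k\<close> and the quotient
    undo the halved diameter and the normalisation in \<open>hausdorff_weight\<close>.\<close>
  define c where "c = 3 * 2 ^ DIM('a) * ?w * 2 ^ ?k / unit_ball_vol (real ?k)"
  have "c > 0" by (simp add: c_def unit_ball_vol_pos)
  have cancel: "x * d = (x * p / b) * (b * (d / p))" if "b > 0" "p > 0" for x d p b :: real
    using that by simp
  \<comment> \<open>The single scale 1 suffices for a lower bound of a supremum over all scales, and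
    it provides the bound on the radius required for the cones.\<close>
  have "ennreal (?w / c) \<le> hausdorff_premeasure ?k 1 (sphere (0::'a) 1)"
    unfolding hausdorff_premeasure_def
  proof (rule INF_greatest)
    fix U :: "nat \<Rightarrow> 'a set"
    assume "U \<in> {U. sphere 0 1 \<subseteq> (\<Union>i. U i) \<and> (\<forall>i. bounded (U i) \<and> diameter (U i) \<le> 1)}"
    then have cov: "sphere 0 1 \<subseteq> (\<Union>i. U i)" and bd: "\<And>i. bounded (U i)"
      and dm: "\<And>i. diameter (U i) \<le> 1"
      by auto
    define u where "u i = (SOME x. x \<in> U i \<inter> sphere 0 1)" for i
    \<comment> \<open>The covering sets are arbitrary. A closed ball about a point of
      \<open>U i\<close> on the sphere replaces \<open>U i\<close>, so that the cone is compact and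
      hence measurable.\<close>
    define C where "C i = (if U i \<inter> sphere 0 1 = {} then {} else
      (\<lambda>(t, x). t *\<^sub>R x) ` ({0..1} \<times> cball (u i) (diameter (U i))))" for i
    have u: "u i \<in> U i" "norm (u i) = 1" if "U i \<inter> sphere 0 1 \<noteq> {}" for i
    proof -
      have "\<exists>x. x \<in> U i \<inter> sphere 0 1" using that by blast
      then have "u i \<in> U i \<inter> sphere 0 1" unfolding u_def by (rule someI_ex)
      then show "u i \<in> U i" "norm (u i) = 1" by auto
    qed
    have Cle: "emeasure lborel (C i) \<le> ennreal c * hausdorff_weight ?k (U i)" for i
    proof (cases "U i \<inter> sphere 0 1 = {}")
      case False
      then have "emeasure lborel (C i) \<le> ennreal (3 * 2 ^ DIM('a) * ?w * diameter (U i) ^ ?k)"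
        unfolding C_def using u[OF False] assms dm diameter_ge_0[OF bd]
        by (simp only: if_False) (intro emeasure_cone_cball_le, auto)
      also have "3 * 2 ^ DIM('a) * ?w * diameter (U i) ^ ?k
          = c * (unit_ball_vol (real ?k) * (diameter (U i) / 2) ^ ?k)"
        unfolding c_def power_divide by (rule cancel) (simp_all add: unit_ball_vol_pos)
      also have "ennreal \<dots> = ennreal c * hausdorff_weight ?k (U i)"
        using False \<open>c > 0\<close> diameter_ge_0[OF bd, of i]
        by (subst ennreal_mult) (auto simp: hausdorff_weight_def)
      finally show ?thesis .
    qed (simp add: C_def)
    have Cm: "C i \<in> sets lborel" for i
    proof -
      have "compact ((\<lambda>(t, x). t *\<^sub>R x) ` ({0..1::real} \<times> cball (u i) (diameter (U i))))"
        by (intro compact_continuous_image compact_Times)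
          (auto simp: case_prod_unfold intro!: continuous_intros)
      then show ?thesis by (simp add: C_def borel_compact)
    qed
    have "cball (0::'a) 1 \<subseteq> (\<Union>i. C i)"
    proof
      fix x :: 'a assume x: "x \<in> cball 0 1"
      obtain v :: 'a where v: "norm v = 1" "x = norm x *\<^sub>R v"
      proof (cases "x = 0")
        case True
        then show ?thesis using that[of "SOME b. b \<in> Basis"] by (simp add: SOME_Basis norm_Basis)
      next
        case False
        then show ?thesis using that[of "x /\<^sub>R norm x"] by simp
      qed
      then obtain i where i: "v \<in> U i" using cov by auto
      then have ne: "U i \<inter> sphere 0 1 \<noteq> {}" using v by auto
      have "v \<in> cball (u i) (diameter (U i))"
        using diameter_bounded_bound[OF bd u(1)[OF ne] i] by simp
      then have "(norm x, v) \<in> {0..1} \<times> cball (u i) (diameter (U i))" using x by simp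
      then have "norm x *\<^sub>R v \<in> C i" unfolding C_def using ne by force
      then show "x \<in> (\<Union>i. C i)" using v(2) by auto
    qed
    then have "emeasure lborel (cball (0::'a) 1) \<le> emeasure lborel (\<Union>i. C i)"
      using Cm by (intro emeasure_mono) auto
    also have "\<dots> \<le> (\<Sum>i. emeasure lborel (C i))"
      using Cm by (intro emeasure_subadditive_countably) auto
    also have "\<dots> \<le> (\<Sum>i. ennreal c * hausdorff_weight ?k (U i))"
      by (intro suminf_le Cle) auto
    finally have "ennreal ?w \<le> ennreal c * (\<Sum>i. hausdorff_weight ?k (U i))"
      by (simp add: emeasure_cball)
    then have "ennreal (1 / c) * ennreal ?w \<le> ennreal (1 / c) * (ennreal c * (\<Sum>i. hausdorff_weight ?k (U i)))"
      by (rule mult_left_mono) simp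
    also have "\<dots> = (\<Sum>i. hausdorff_weight ?k (U i))"
      using \<open>c > 0\<close> by (simp flip: mult.assoc ennreal_mult)
    finally show "ennreal (?w / c) \<le> (\<Sum>i. hausdorff_weight ?k (U i))"
      using \<open>c > 0\<close> by (simp flip: ennreal_mult)
  qed
  also have "\<dots> \<le> hausdorff_outer_measure ?k (sphere (0::'a) 1)"
    unfolding hausdorff_outer_measure_def by (intro SUP_upper) auto
  finally have "ennreal (?w / c) \<le> hausdorff_outer_measure ?k (sphere (0::'a) 1)" .
  moreover have "0 < ennreal (?w / c)" using \<open>c > 0\<close> by (simp add: unit_ball_vol_pos)
  ultimately show ?thesis by (rule less_le_trans[rotated])
qed

subsection \<open>Integration over the sphere\<close>

text \<open>Restricting the space makes the measure finite, as the exchange of integrals for slabs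
  requires; the Hausdorff measure of dimension \<open>n - 1\<close> on all of the space is not
  \<sigma>-finite.\<close>

definition sphere_measure :: "'a::euclidean_space measure" where
  "sphere_measure = restrict_space (hausdorff_measure (DIM('a) - 1)) (sphere 0 1)"

lemma space_sphere_measure [simp]: "space sphere_measure = sphere 0 1"
  by (simp add: sphere_measure_def space_restrict_space)

lemma sets_sphere_measure [measurable_cong]:
  "sets sphere_measure = sets (restrict_space borel (sphere (0::'a::euclidean_space) 1))"
  unfolding sphere_measure_def by (rule sets_restrict_space_cong) simp

lemma borel_measurable_sphere_measure:
  "f \<in> borel_measurable borel \<Longrightarrow> f \<in> borel_measurable sphere_measure"
  unfolding sphere_measure_def
  by (intro measurable_restrict_space1) (simp add: measurable_cong_sets[OF sets_hausdorff_measure refl])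

lemma continuous_on_measurable_sphere_measure:
  fixes f :: "'a::euclidean_space \<Rightarrow> real"
  assumes "continuous_on (sphere 0 1) f"
  shows "f \<in> borel_measurable sphere_measure"
  using borel_measurable_continuous_on_restrict[OF assms]
  by (simp add: measurable_cong_sets[OF sets_sphere_measure refl])

lemma set_integral_sphere_eq:
  fixes f :: "'a::euclidean_space \<Rightarrow> real"
  shows "(LINT \<xi>:sphere 0 1|hausdorff_measure (DIM('a) - 1). f \<xi>) = (LINT \<xi>|sphere_measure. f \<xi>)"
  by (simp add: sphere_measure_def integral_restrict_space set_lebesgue_integral_def borel_closed)

lemma emeasure_sphere_measure:
  fixes A :: "'a::euclidean_space set"
  assumes "A \<in> sets borel"
  shows "emeasure sphere_measure (A \<inter> sphere 0 1) = hausdorff_outer_measure (DIM('a) - 1) (A \<inter> sphere 0 1)"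
  using assms
  by (simp add: sphere_measure_def emeasure_restrict_space borel_closed emeasure_hausdorff_measure)

interpretation sphere_measure: finite_measure "sphere_measure :: 'a::euclidean_space measure"
proof
  have "emeasure sphere_measure (sphere (0::'a) 1) < \<infinity>"
    using emeasure_sphere_measure[of "UNIV :: 'a set"] hausdorff_outer_measure_sphere_finite[where 'a = 'a]
    by simp
  then show "emeasure sphere_measure (space (sphere_measure :: 'a measure)) \<noteq> \<infinity>" by simp
qed

lemma measure_sphere_measure_pos:
  assumes "DIM('a::euclidean_space) \<ge> 2"
  shows "0 < measure sphere_measure (sphere (0::'a) 1)"
proof -
  have "0 < emeasure sphere_measure (sphere (0::'a) 1)"
    using emeasure_sphere_measure[of "UNIV :: 'a set"] hausdorff_outer_measure_sphere_pos[OF assms]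
    by simp
  then show ?thesis
    unfolding sphere_measure.emeasure_eq_measure by (simp only: ennreal_less_zero_iff)
qed

lemma measurable_reflect: "reflect w \<in> borel_measurable borel" for w :: "'a::euclidean_space"
  by (intro borel_measurable_continuous_onI linear_continuous_on linear_conv_bounded_linear[THEN iffD1] linear_reflect)

lemma measurable_reflect_sphere: "reflect w \<in> measurable sphere_measure sphere_measure"
proof -
  have "reflect w \<in> measurable sphere_measure (restrict_space borel (sphere 0 1))"
    by (rule measurable_restrict_space2) (auto intro: borel_measurable_sphere_measure measurable_reflect)
  then show ?thesis
    by (simp add: measurable_cong_sets[OF refl sets_sphere_measure])
qed

lemma sets_sphere_measureE:
  fixes A :: "'a::euclidean_space set"
  assumes "A \<in> sets sphere_measure"
  obtains B where "B \<in> sets borel" "A = B \<inter> sphere 0 1"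
  using assms by (auto simp: sets_sphere_measure sets_restrict_space)

text \<open>A reflection is its own inverse, so a preimage is an image, and images keep their outer
  measure.\<close>

lemma distr_reflect_sphere_measure:
  "distr sphere_measure sphere_measure (reflect w) = (sphere_measure :: 'a::euclidean_space measure)"
proof (rule measure_eqI)
  fix A :: "'a set"
  assume "A \<in> sets (distr sphere_measure sphere_measure (reflect w))"
  then have A: "A \<in> sets sphere_measure" by simp
  then obtain B where B: "B \<in> sets borel" "A = B \<inter> sphere 0 1" by (rule sets_sphere_measureE)
  have B': "reflect w -` B \<in> sets borel"
    using measurable_sets[OF measurable_reflect B(1), of w] by simp
  have eq1: "reflect w -` A \<inter> space sphere_measure = reflect w -` B \<inter> sphere 0 1"
    using B by auto
  have eq2: "reflect w -` B \<inter> sphere 0 1 = reflect w ` A"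
    unfolding reflect_image_eq_vimage B(2) by auto
  have "emeasure sphere_measure (reflect w -` A \<inter> space sphere_measure)
      = hausdorff_outer_measure (DIM('a) - 1) (reflect w -` B \<inter> sphere 0 1)"
    unfolding eq1 using B' by (rule emeasure_sphere_measure)
  also have "\<dots> = hausdorff_outer_measure (DIM('a) - 1) A"
    unfolding eq2 by (rule hausdorff_outer_measure_reflect)
  also have "\<dots> = emeasure sphere_measure A"
    unfolding B(2) by (rule emeasure_sphere_measure[OF B(1), symmetric])
  finally show "emeasure (distr sphere_measure sphere_measure (reflect w)) A = emeasure sphere_measure A"
    by (simp add: emeasure_distr[OF measurable_reflect_sphere A])
qed simp

lemma integral_reflect_sphere:
  fixes f :: "'a::euclidean_space \<Rightarrow> real"
  assumes "f \<in> borel_measurable sphere_measure"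
  shows "(LINT \<xi>|sphere_measure. f (reflect w \<xi>)) = (LINT \<xi>|sphere_measure. f \<xi>)"
  using integral_distr[OF measurable_reflect_sphere assms, of w]
  by (simp add: distr_reflect_sphere_measure)

text \<open>The choice of the unit vector is immaterial by invariance. The integral is not divided
  by the total mass.\<close>

definition mean_projection :: "'a::euclidean_space itself \<Rightarrow> real" where
  "mean_projection _ = (LINT \<xi>|sphere_measure. \<bar>(SOME b. b \<in> Basis) \<bullet> (\<xi>::'a)\<bar>)"

lemma integrable_sphere_bounded:
  fixes f :: "'a::euclidean_space \<Rightarrow> real"
  assumes "f \<in> borel_measurable sphere_measure" "\<And>\<xi>. norm \<xi> = 1 \<Longrightarrow> \<bar>f \<xi>\<bar> \<le> B"
  shows "integrable sphere_measure f"
  using assms by (intro sphere_measure.integrable_const_bound[of _ B] AE_I2) auto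

lemma abs_inner_measurable_sphere: "(\<lambda>\<xi>. \<bar>z \<bullet> \<xi>\<bar>) \<in> borel_measurable sphere_measure"
  by (intro continuous_on_measurable_sphere_measure continuous_intros)

lemma sets_sphere_slab: "{\<xi> \<in> sphere 0 1. \<bar>v \<bullet> \<xi>\<bar> \<le> e} \<in> sets sphere_measure"
  using measurable_sets[OF abs_inner_measurable_sphere[of v], of "{..e}"]
  by (simp add: vimage_def Int_def conj_commute)

lemma integrable_abs_inner: "integrable sphere_measure (\<lambda>\<xi>. \<bar>z \<bullet> \<xi>\<bar>)"
proof (rule integrable_sphere_bounded)
  show "\<bar>\<bar>z \<bullet> \<xi>\<bar>\<bar> \<le> norm z" if "norm \<xi> = 1" for \<xi>
    using Cauchy_Schwarz_ineq2[of z \<xi>] that by simp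
qed (rule abs_inner_measurable_sphere)

text \<open>The reflection that interchanges \<open>z\<close> and \<open>norm z *\<^sub>R b\<close>
  carries the integral over to the fixed axis \<open>b\<close>.\<close>

lemma integral_abs_inner:
  "(LINT \<xi>|sphere_measure. \<bar>z \<bullet> (\<xi>::'a::euclidean_space)\<bar>) = norm z * mean_projection TYPE('a)"
proof -
  define b where "b = (SOME b. b \<in> (Basis :: 'a set))"
  have "norm b = 1" unfolding b_def by (simp add: SOME_Basis norm_Basis)
  define w where "w = norm z *\<^sub>R b - z"
  have w: "reflect w (norm z *\<^sub>R b) = z"
    unfolding w_def by (rule reflect_swap) (simp add: \<open>norm b = 1\<close>)
  have "(LINT \<xi>|sphere_measure. \<bar>z \<bullet> \<xi>\<bar>) = (LINT \<xi>|sphere_measure. \<bar>z \<bullet> reflect w \<xi>\<bar>)"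
    by (rule integral_reflect_sphere[symmetric, OF abs_inner_measurable_sphere])
  also have "\<dots> = (LINT \<xi>|sphere_measure. norm z * \<bar>b \<bullet> \<xi>\<bar>)"
  proof (rule arg_cong[of _ _ "integral\<^sup>L sphere_measure"], rule ext)
    fix \<xi>
    have "z \<bullet> reflect w \<xi> = norm z * (b \<bullet> \<xi>)"
      unfolding inner_reflect using w by (metis reflect_reflect inner_scaleR_left)
    then show "\<bar>z \<bullet> reflect w \<xi>\<bar> = norm z * \<bar>b \<bullet> \<xi>\<bar>" by (simp add: abs_mult)
  qed
  also have "\<dots> = norm z * (LINT \<xi>|sphere_measure. \<bar>b \<bullet> \<xi>\<bar>)" by simp
  finally show ?thesis unfolding mean_projection_def b_def[symmetric] .
qed

text \<open>No single direction has to be estimated: on the sphere the absolute coordinates add up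
  to at least 1, and all of them have the same integral.\<close>

lemma mean_projection_pos:
  assumes "DIM('a::euclidean_space) \<ge> 2"
  shows "0 < mean_projection TYPE('a)"
proof -
  have "0 < measure sphere_measure (sphere (0::'a) 1)"
    by (rule measure_sphere_measure_pos[OF assms])
  also have "\<dots> = (LINT \<xi>|(sphere_measure :: 'a measure). 1)"
    by simp
  also have "\<dots> \<le> (LINT \<xi>|(sphere_measure :: 'a measure). (\<Sum>b\<in>Basis. \<bar>b \<bullet> \<xi>\<bar>))"
  proof (rule integral_mono)
    show "1 \<le> (\<Sum>b\<in>Basis. \<bar>b \<bullet> \<xi>\<bar>)" if "\<xi> \<in> space sphere_measure" for \<xi> :: 'a
      using norm_le_l1[of \<xi>] that by (simp add: inner_commute)
  qed (auto intro: integrable_abs_inner)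
  also have "\<dots> = (\<Sum>b\<in>(Basis::'a set). norm b * mean_projection TYPE('a))"
    by (subst Bochner_Integration.integral_sum) (auto intro: integrable_abs_inner simp: integral_abs_inner)
  also have "\<dots> = real DIM('a) * mean_projection TYPE('a)" by simp
  finally show ?thesis by (simp add: zero_less_mult_iff)
qed

section \<open>Measure of slabs and integrability of the logarithm\<close>

text \<open>Sufficiently many disjoint translates of the slab fit into a ball of radius 4.\<close>

lemma emeasure_slab_le:
  fixes \<xi> :: "'a::euclidean_space"
  assumes "norm \<xi> = 1" "0 < e" "e \<le> 1"
  shows "emeasure lborel {v \<in> cball 0 1. \<bar>v \<bullet> \<xi>\<bar> \<le> e} \<le> ennreal (unit_ball_vol (real DIM('a)) * 4 ^ DIM('a) * e)"
proof -
  define A where "A = {v \<in> cball (0::'a) 1. \<bar>v \<bullet> \<xi>\<bar> \<le> e}"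
  define N where "N = nat \<lfloor>1 / e\<rfloor>"
  have "closed {v. \<bar>v \<bullet> \<xi>\<bar> \<le> e}"
    by (intro closed_Collect_le continuous_intros)
  then have "compact (cball (0::'a) 1 \<inter> {v. \<bar>v \<bullet> \<xi>\<bar> \<le> e})"
    by (rule compact_Int_closed[OF compact_cball])
  then have "compact A" by (simp add: A_def Int_def)
  \<comment> \<open>The spacing \<open>3 * e\<close> exceeds the slab width \<open>2 * e\<close>, so
    the translates are disjoint. For \<open>j \<le> N \<le> 1 / e\<close> the displacement is at
    most 3, which with the unit ball gives the radius 4.\<close>
  define T where "T j = (+) ((3 * e * real j) *\<^sub>R \<xi>) ` A" for j
  have Tc: "compact (T j)" for j
    unfolding T_def using \<open>compact A\<close> by (rule compact_translation)
  have "\<xi> \<bullet> \<xi> = 1" using assms by (simp add: dot_square_norm)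
  have N: "real N \<le> 1 / e" "1 / e < real N + 1"
    using \<open>0 < e\<close> unfolding N_def by (auto simp: of_nat_nat)
  have near: "\<bar>x \<bullet> \<xi> - 3 * e * real j\<bar> \<le> e" if "x \<in> T j" for x j
    using that \<open>\<xi> \<bullet> \<xi> = 1\<close> by (auto simp: T_def A_def inner_add_left)
  have "real (Suc N) * measure lebesgue A = (\<Sum>j\<le>N. measure lebesgue (T j))"
    by (simp add: T_def measure_translation)
  also have "\<dots> = measure lebesgue (\<Union>j\<in>{..N}. T j)"
  proof (rule measure_UNION'[symmetric])
    show "pairwise (\<lambda>i j. disjnt (T i) (T j)) {..N}"
    proof (intro pairwiseI)
      fix i j :: nat assume "i \<noteq> j"
      show "disjnt (T i) (T j)"
        unfolding disjnt_def
      proof (rule equals0I)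
        fix x assume "x \<in> T i \<inter> T j"
        then have "\<bar>x \<bullet> \<xi> - 3 * e * real i\<bar> \<le> e" "\<bar>x \<bullet> \<xi> - 3 * e * real j\<bar> \<le> e"
          using near by auto
        then have "\<bar>3 * e * real i - 3 * e * real j\<bar> \<le> 2 * e" by linarith
        then have "e * (3 * \<bar>real i - real j\<bar>) \<le> e * 2"
          using \<open>0 < e\<close> by (simp add: abs_mult flip: right_diff_distrib)
        then have "3 * \<bar>real i - real j\<bar> \<le> 2" using \<open>0 < e\<close> by simp
        moreover have "1 \<le> \<bar>real i - real j\<bar>" using \<open>i \<noteq> j\<close> by linarith
        ultimately show False by simp
      qed
    qed
  qed (use Tc in \<open>simp_all add: lmeasurable_compact\<close>)
  also have "\<dots> \<le> measure lebesgue (cball (0::'a) 4)"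
  proof (rule measure_mono_fmeasurable)
    show "(\<Union>j\<in>{..N}. T j) \<subseteq> cball 0 4"
    proof clarify
      fix j x assume "j \<le> N" "x \<in> T j"
      then obtain v where v: "x = (3 * e * real j) *\<^sub>R \<xi> + v" "norm v \<le> 1"
        by (auto simp: T_def A_def)
      have "e * real j \<le> e * real N" using \<open>j \<le> N\<close> \<open>0 < e\<close> by simp
      also have "\<dots> \<le> 1" using N \<open>0 < e\<close> by (simp add: field_simps)
      finally have "norm ((3 * e * real j) *\<^sub>R \<xi>) \<le> 3" using assms by simp
      then show "x \<in> cball 0 4"
        using norm_triangle_ineq[of "(3 * e * real j) *\<^sub>R \<xi>" v] v by simp
    qed
    show "(\<Union>j\<in>{..N}. T j) \<in> sets lebesgue"
      using Tc by (intro sets.finite_UN) (simp_all add: lmeasurable_compact fmeasurableD)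
  qed simp
  also have "\<dots> = unit_ball_vol (real DIM('a)) * 4 ^ DIM('a)"
    by (simp add: content_cball)
  finally have "(real N + 1) * measure lebesgue A \<le> unit_ball_vol (real DIM('a)) * 4 ^ DIM('a)"
    by (simp add: add.commute)
  moreover have "1 / e * measure lebesgue A \<le> (real N + 1) * measure lebesgue A"
    using N by (intro mult_right_mono) auto
  ultimately have "1 / e * measure lebesgue A \<le> unit_ball_vol (real DIM('a)) * 4 ^ DIM('a)"
    by linarith
  then have "measure lebesgue A \<le> unit_ball_vol (real DIM('a)) * 4 ^ DIM('a) * e"
    using \<open>0 < e\<close> by (simp add: field_simps)
  moreover have "emeasure lborel A = ennreal (measure lebesgue A)"
    using \<open>compact A\<close> emeasure_eq_measure2[OF lmeasurable_compact[OF \<open>compact A\<close>]]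
    by (simp add: borel_compact)
  ultimately show ?thesis unfolding A_def[symmetric] by (simp add: ennreal_leI)
qed

lemma emeasure_sphere_slab_eq:
  fixes a b :: "'a::euclidean_space"
  assumes "norm a = norm b"
  shows "emeasure sphere_measure {\<xi> \<in> sphere 0 1. \<bar>a \<bullet> \<xi>\<bar> \<le> e} = emeasure sphere_measure {\<xi> \<in> sphere 0 1. \<bar>b \<bullet> \<xi>\<bar> \<le> e}"
proof -
  define w where "w = a - b"
  have w: "reflect w a = b" unfolding w_def by (rule reflect_swap[OF assms])
  have "emeasure sphere_measure {\<xi> \<in> sphere 0 1. \<bar>a \<bullet> \<xi>\<bar> \<le> e}
      = emeasure (distr sphere_measure sphere_measure (reflect w)) {\<xi> \<in> sphere 0 1. \<bar>a \<bullet> \<xi>\<bar> \<le> e}"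
    by (simp only: distr_reflect_sphere_measure)
  also have "\<dots> = emeasure sphere_measure (reflect w -` {\<xi> \<in> sphere 0 1. \<bar>a \<bullet> \<xi>\<bar> \<le> e} \<inter> space sphere_measure)"
    by (rule emeasure_distr[OF measurable_reflect_sphere sets_sphere_slab])
  also have "reflect w -` {\<xi> \<in> sphere 0 1. \<bar>a \<bullet> \<xi>\<bar> \<le> e} \<inter> space sphere_measure = {\<xi> \<in> sphere 0 1. \<bar>b \<bullet> \<xi>\<bar> \<le> e}"
    by (auto simp: inner_reflect w)
  finally show ?thesis .
qed

text \<open>
  The measure of a slab is independent of its unit normal vector, so that it can be averaged over
  the unit ball and estimated by exchanging the order of integration.
\<close>

lemma emeasure_sphere_slab_le:
  fixes u :: "'a::euclidean_space"
  assumes "norm u = 1" "0 < e" "e \<le> 1"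
  shows "emeasure sphere_measure {\<xi> \<in> sphere 0 1. \<bar>u \<bullet> \<xi>\<bar> \<le> e}
    \<le> ennreal (4 ^ DIM('a) * measure sphere_measure (sphere (0::'a) 1) * e)"
proof -
  let ?w = "unit_ball_vol (real DIM('a))"
  define a where "a = emeasure sphere_measure {\<xi> \<in> sphere 0 1. \<bar>u \<bullet> \<xi>\<bar> \<le> e}"
  define f where "f \<xi> v = (indicator {v \<in> cball (0::'a) 1. \<bar>v \<bullet> \<xi>\<bar> \<le> e} v :: ennreal)" for \<xi> v :: 'a
  have id: "(\<lambda>\<xi>. \<xi>) \<in> borel_measurable (sphere_measure :: 'a measure)"
    by (rule borel_measurable_sphere_measure) simp
  have fm: "case_prod f \<in> borel_measurable (sphere_measure \<Otimes>\<^sub>M lborel)"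
  proof -
    have [measurable]: "fst \<in> borel_measurable ((sphere_measure :: 'a measure) \<Otimes>\<^sub>M (lborel :: 'a measure))"
      using measurable_comp[OF measurable_fst id, of "lborel :: 'a measure"] by (simp add: comp_def)
    have [measurable]: "snd \<in> borel_measurable ((sphere_measure :: 'a measure) \<Otimes>\<^sub>M (lborel :: 'a measure))"
      using measurable_snd[of "sphere_measure :: 'a measure" "lborel :: 'a measure"] by simp
    have "(\<lambda>p. if norm (snd p :: 'a) \<le> 1 \<and> \<bar>snd p \<bullet> (fst p :: 'a)\<bar> \<le> e then 1 else 0 :: ennreal)
        \<in> borel_measurable (sphere_measure \<Otimes>\<^sub>M lborel)"
      by measurable
    also have "(\<lambda>p. if norm (snd p :: 'a) \<le> 1 \<and> \<bar>snd p \<bullet> (fst p :: 'a)\<bar> \<le> e then 1 else 0 :: ennreal) = case_prod f"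
      by (auto simp: f_def indicator_def fun_eq_iff)
    finally show ?thesis .
  qed
  \<comment> \<open>Shortening the normal vector only enlarges the slab, so the slab of each
    \<open>v\<close> in the unit ball, including 0, has at least the measure \<open>a\<close> of the
    slab of a unit vector.\<close>
  have inner: "a * indicator (cball 0 1) v \<le> (\<integral>\<^sup>+\<xi>. f \<xi> v \<partial>sphere_measure)" for v
  proof (cases "v \<in> cball 0 1")
    case True
    have "a \<le> emeasure sphere_measure {\<xi> \<in> sphere 0 1. \<bar>v \<bullet> \<xi>\<bar> \<le> e}"
    proof (cases "v = 0")
      case True
      then show ?thesis unfolding a_def
        using assms sets_sphere_slab[of 0 e] by (intro emeasure_mono) auto
    next
      case False
      have "a = emeasure sphere_measure {\<xi> \<in> sphere 0 1. \<bar>(v /\<^sub>R norm v) \<bullet> \<xi>\<bar> \<le> e}"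
        unfolding a_def using False assms by (intro emeasure_sphere_slab_eq) simp
      also have "\<dots> \<le> emeasure sphere_measure {\<xi> \<in> sphere 0 1. \<bar>v \<bullet> \<xi>\<bar> \<le> e}"
      proof (intro emeasure_mono sets_sphere_slab subsetI CollectI conjI)
        fix \<xi> assume \<xi>: "\<xi> \<in> {\<xi> \<in> sphere 0 1. \<bar>(v /\<^sub>R norm v) \<bullet> \<xi>\<bar> \<le> e}"
        have "\<bar>v \<bullet> \<xi>\<bar> = norm v * \<bar>(v /\<^sub>R norm v) \<bullet> \<xi>\<bar>"
          using False by (simp add: abs_mult)
        also have "\<dots> \<le> 1 * e" using True \<xi> assms by (intro mult_mono) auto
        finally show "\<bar>v \<bullet> \<xi>\<bar> \<le> e" by simp
      qed auto
      finally show ?thesis .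
    qed
    also have "\<dots> = (\<integral>\<^sup>+\<xi>. indicator {\<xi> \<in> sphere 0 1. \<bar>v \<bullet> \<xi>\<bar> \<le> e} \<xi> \<partial>sphere_measure)"
      using sets_sphere_slab[of v e] by simp
    also have "\<dots> = (\<integral>\<^sup>+\<xi>. f \<xi> v \<partial>sphere_measure)"
      using True by (intro nn_integral_cong) (simp add: f_def indicator_def)
    finally show ?thesis using True by simp
  qed simp
  interpret pair_sigma_finite "sphere_measure :: 'a measure" "lborel :: 'a measure" ..
  have "a * ennreal ?w = (\<integral>\<^sup>+v. a * indicator (cball (0::'a) 1) v \<partial>lborel)"
    by (subst nn_integral_cmult) (simp_all add: emeasure_cball borel_measurable_indicator borel_closed)
  also have "\<dots> \<le> (\<integral>\<^sup>+v. \<integral>\<^sup>+\<xi>. f \<xi> v \<partial>sphere_measure \<partial>lborel)"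
    by (intro nn_integral_mono inner)
  also have "\<dots> = (\<integral>\<^sup>+\<xi>. \<integral>\<^sup>+v. f \<xi> v \<partial>lborel \<partial>sphere_measure)"
    using fm by (rule Fubini')
  also have "\<dots> \<le> (\<integral>\<^sup>+(\<xi>::'a). ennreal (?w * 4 ^ DIM('a) * e) \<partial>sphere_measure)"
  proof (rule nn_integral_mono)
    fix \<xi> :: 'a assume "\<xi> \<in> space sphere_measure"
    then have "norm \<xi> = 1" by simp
    have "closed (cball 0 1 \<inter> {v. \<bar>v \<bullet> \<xi>\<bar> \<le> e})"
      by (intro closed_Int closed_cball closed_Collect_le continuous_intros)
    then have "{v \<in> cball 0 1. \<bar>v \<bullet> \<xi>\<bar> \<le> e} \<in> sets lborel"
      by (simp add: Int_def borel_closed)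
    then have "(\<integral>\<^sup>+v. f \<xi> v \<partial>lborel) = emeasure lborel {v \<in> cball 0 1. \<bar>v \<bullet> \<xi>\<bar> \<le> e}"
      unfolding f_def by (rule nn_integral_indicator)
    also have "\<dots> \<le> ennreal (?w * 4 ^ DIM('a) * e)"
      using \<open>norm \<xi> = 1\<close> assms by (intro emeasure_slab_le)
    finally show "(\<integral>\<^sup>+v. f \<xi> v \<partial>lborel) \<le> ennreal (?w * 4 ^ DIM('a) * e)" .
  qed
  also have "\<dots> = ennreal (4 ^ DIM('a) * measure sphere_measure (sphere (0::'a) 1) * e) * ennreal ?w"
    using assms by (simp add: sphere_measure.emeasure_eq_measure ac_simps flip: ennreal_mult)
  finally have "a * ennreal ?w \<le> ennreal (4 ^ DIM('a) * measure sphere_measure (sphere (0::'a) 1) * e) * ennreal ?w" .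
  then have "a * ennreal ?w * ennreal (1 / ?w)
      \<le> ennreal (4 ^ DIM('a) * measure sphere_measure (sphere (0::'a) 1) * e) * ennreal ?w * ennreal (1 / ?w)"
    by (rule mult_right_mono) simp
  moreover have "ennreal ?w * ennreal (1 / ?w) = 1"
  proof -
    have "?w \<noteq> 0" using unit_ball_vol_pos[of "real DIM('a)"] by linarith
    then show ?thesis by (simp flip: ennreal_mult)
  qed
  ultimately show ?thesis by (simp add: mult.assoc a_def)
qed

text \<open>A discrete layer cake formula: for positive \<open>s\<close> the sum counts the
  \<open>k\<close> with \<open>k \<le> - ln s\<close>, and there are more than \<open>- ln s\<close>
  of them. At 0 the left side vanishes, as \<open>ln 0 = 0\<close> by convention.\<close>

lemma ln_le_count_exp:
  fixes s :: real
  assumes "0 \<le> s" "s \<le> 1"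
  shows "ennreal \<bar>ln s\<bar> \<le> (\<Sum>k. indicator {..exp (- real k)} s)"
proof (cases "s = 0")
  case False
  then have "0 < s" using assms by simp
  define m where "m = nat \<lfloor>- ln s\<rfloor>"
  have "ln s \<le> 0" using assms \<open>0 < s\<close> by simp
  then have m: "real m \<le> - ln s" "- ln s \<le> real (Suc m)"
    unfolding m_def by (simp_all add: of_nat_nat) linarith
  have le: "s \<le> exp (- real k)" if "k \<le> m" for k
  proof -
    have "ln s \<le> - real k" using m that by linarith
    then show ?thesis using \<open>0 < s\<close> by (metis exp_le_cancel_iff exp_ln)
  qed
  have "ennreal \<bar>ln s\<bar> \<le> ennreal (real (Suc m))"
    using m \<open>ln s \<le> 0\<close> by (intro ennreal_leI) linarith
  also have "\<dots> = (\<Sum>k\<in>{..m}. indicator {..exp (- real k)} s)"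
    using le by (simp add: ennreal_of_nat_eq_real_of_nat)
  also have "\<dots> \<le> (\<Sum>k. indicator {..exp (- real k)} s)"
    by (intro sum_le_suminf) auto
  finally show ?thesis .
qed simp

text \<open>The layers are slabs of half-width \<open>exp (- k)\<close>, whose measures are bounded
  by the terms of a geometric series.\<close>

lemma integrable_ln_abs_inner:
  fixes u :: "'a::euclidean_space"
  assumes "norm u = 1"
  shows "integrable sphere_measure (\<lambda>\<xi>. ln \<bar>u \<bullet> \<xi>\<bar>)"
proof (rule integrableI_bounded)
  show "(\<lambda>\<xi>. ln \<bar>u \<bullet> \<xi>\<bar>) \<in> borel_measurable sphere_measure"
    using measurable_comp[OF abs_inner_measurable_sphere borel_measurable_ln[OF measurable_ident]]
    by (simp add: comp_def)
  let ?C = "4 ^ DIM('a) * measure sphere_measure (sphere (0::'a) 1)"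
  have geom: "summable (\<lambda>k. exp (- 1 :: real) ^ k)" by (rule summable_geometric) simp
  have "(\<integral>\<^sup>+\<xi>. norm (ln \<bar>u \<bullet> \<xi>\<bar>) \<partial>sphere_measure)
      \<le> (\<integral>\<^sup>+\<xi>. (\<Sum>k. indicator {\<xi> \<in> sphere 0 1. \<bar>u \<bullet> \<xi>\<bar> \<le> exp (- real k)} \<xi>) \<partial>sphere_measure)"
  proof (rule nn_integral_mono)
    fix \<xi> :: 'a assume \<xi>: "\<xi> \<in> space sphere_measure"
    have "\<bar>u \<bullet> \<xi>\<bar> \<le> 1" using Cauchy_Schwarz_ineq2[of u \<xi>] \<xi> assms by simp
    then have "ennreal \<bar>ln \<bar>u \<bullet> \<xi>\<bar>\<bar> \<le> (\<Sum>k. indicator {..exp (- real k)} \<bar>u \<bullet> \<xi>\<bar>)"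
      by (intro ln_le_count_exp) auto
    also have "\<dots> = (\<Sum>k. indicator {\<xi> \<in> sphere 0 1. \<bar>u \<bullet> \<xi>\<bar> \<le> exp (- real k)} \<xi>)"
      using \<xi> by (simp add: indicator_def)
    finally show "ennreal (norm (ln \<bar>u \<bullet> \<xi>\<bar>)) \<le> \<dots>" by simp
  qed
  also have "\<dots> = (\<Sum>k. emeasure sphere_measure {\<xi> \<in> sphere 0 1. \<bar>u \<bullet> \<xi>\<bar> \<le> exp (- real k)})"
    using sets_sphere_slab[of u] by (subst nn_integral_suminf) auto
  also have "\<dots> \<le> (\<Sum>k. ennreal (?C * exp (- real k)))"
    using assms by (intro suminf_le emeasure_sphere_slab_le) auto
  also have "\<dots> = (\<Sum>k. ennreal (?C * exp (- 1) ^ k))"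
    by (simp add: exp_of_nat_mult[symmetric])
  also have "\<dots> = ennreal (\<Sum>k. ?C * exp (- 1) ^ k)"
    using geom by (intro suminf_ennreal2 summable_mult) auto
  also have "\<dots> < \<infinity>" by simp
  finally show "(\<integral>\<^sup>+\<xi>. norm (ln \<bar>u \<bullet> \<xi>\<bar>) \<partial>sphere_measure) < \<infinity>" .
qed

subsection \<open>Differentiation under the integral over the sphere\<close>

fun smooth_upto :: "nat \<Rightarrow> real set \<Rightarrow> 'a::topological_space set \<Rightarrow> (real \<Rightarrow> 'a \<Rightarrow> real) \<Rightarrow> bool" where
  "smooth_upto 0 I S g \<longleftrightarrow> continuous_on (I \<times> S) (\<lambda>(t, \<xi>). g t \<xi>)"
| "smooth_upto (Suc k) I S g \<longleftrightarrow> continuous_on (I \<times> S) (\<lambda>(t, \<xi>). g t \<xi>) \<and>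
    (\<exists>g'. (\<forall>t\<in>I. \<forall>\<xi>\<in>S. ((\<lambda>t. g t \<xi>) has_real_derivative g' t \<xi>) (at t)) \<and> smooth_upto k I S g')"

lemma smooth_upto_continuous: "smooth_upto k I S g \<Longrightarrow> continuous_on (I \<times> S) (\<lambda>(t, \<xi>). g t \<xi>)"
  by (cases k) auto

lemma smooth_upto_Suc_imp: "smooth_upto (Suc k) I S g \<Longrightarrow> smooth_upto k I S g"
proof (induction k arbitrary: g)
  case (Suc k)
  from Suc.prems obtain g' where
    "continuous_on (I \<times> S) (\<lambda>(t, \<xi>). g t \<xi>)" "smooth_upto (Suc k) I S g'"
    "\<forall>t\<in>I. \<forall>\<xi>\<in>S. ((\<lambda>t. g t \<xi>) has_real_derivative g' t \<xi>) (at t)"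
    unfolding smooth_upto.simps(2)[of "Suc k"] by blast
  then show ?case using Suc.IH[of g'] by (auto simp del: smooth_upto.simps(1))
qed simp

lemma smooth_upto_SucI:
  assumes "continuous_on (I \<times> S) (\<lambda>(t, \<xi>). g t \<xi>)"
    "\<And>t \<xi>. t \<in> I \<Longrightarrow> \<xi> \<in> S \<Longrightarrow> ((\<lambda>t. g t \<xi>) has_real_derivative g' t \<xi>) (at t)"
    "smooth_upto k I S g'"
  shows "smooth_upto (Suc k) I S g"
  using assms by auto

lemma smooth_upto_SucE:
  assumes "smooth_upto (Suc k) I S g"
  obtains g' where "\<And>t \<xi>. t \<in> I \<Longrightarrow> \<xi> \<in> S \<Longrightarrow> ((\<lambda>t. g t \<xi>) has_real_derivative g' t \<xi>) (at t)"
    "smooth_upto k I S g'"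
  using assms by auto

lemma smooth_upto_param:
  assumes "continuous_on S h"
  shows "smooth_upto k I S (\<lambda>t \<xi>. h \<xi>)"
  using assms
proof (induction k arbitrary: h)
  case 0
  have "continuous_on (I \<times> S) (\<lambda>p. h (snd p))"
    using 0 by (rule continuous_on_compose2) (auto intro!: continuous_intros)
  then show ?case by (simp add: case_prod_unfold)
next
  case (Suc k)
  have "continuous_on (I \<times> S) (\<lambda>p. h (snd p))"
    using Suc.prems by (rule continuous_on_compose2) (auto intro!: continuous_intros)
  then show ?case
    using Suc.IH[of "\<lambda>_. 0"]
    by (intro smooth_upto_SucI[where g' = "\<lambda>_ _. 0"]) (auto simp: case_prod_unfold)
qed

lemma smooth_upto_const: "smooth_upto k I S (\<lambda>t \<xi>. c)"
  by (rule smooth_upto_param) simp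

lemma smooth_upto_id: "smooth_upto k I S (\<lambda>t \<xi>. t)"
proof (cases k)
  case (Suc l)
  show ?thesis
    unfolding Suc
  proof (rule smooth_upto_SucI)
    show "continuous_on (I \<times> S) (\<lambda>(t, \<xi>). t)"
      by (auto simp: case_prod_unfold intro!: continuous_intros)
    show "((\<lambda>t. t) has_real_derivative 1) (at t)" for t by (rule DERIV_ident)
  qed (rule smooth_upto_const)
qed (auto simp: case_prod_unfold intro!: continuous_intros)

lemma smooth_upto_add:
  "smooth_upto k I S f \<Longrightarrow> smooth_upto k I S g \<Longrightarrow> smooth_upto k I S (\<lambda>t \<xi>. f t \<xi> + g t \<xi>)"
proof (induction k arbitrary: f g)
  case (Suc k)
  obtain f' where f': "\<And>t \<xi>. t \<in> I \<Longrightarrow> \<xi> \<in> S \<Longrightarrow> ((\<lambda>t. f t \<xi>) has_real_derivative f' t \<xi>) (at t)"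
    "smooth_upto k I S f'" using Suc.prems(1) by (rule smooth_upto_SucE) (rule that)
  obtain g' where g': "\<And>t \<xi>. t \<in> I \<Longrightarrow> \<xi> \<in> S \<Longrightarrow> ((\<lambda>t. g t \<xi>) has_real_derivative g' t \<xi>) (at t)"
    "smooth_upto k I S g'" using Suc.prems(2) by (rule smooth_upto_SucE) (rule that)
  show ?case
  proof (rule smooth_upto_SucI)
    show "continuous_on (I \<times> S) (\<lambda>(t, \<xi>). f t \<xi> + g t \<xi>)"
      using Suc.prems[THEN smooth_upto_continuous] by (auto simp: case_prod_unfold intro: continuous_on_add)
    show "((\<lambda>t. f t \<xi> + g t \<xi>) has_real_derivative f' t \<xi> + g' t \<xi>) (at t)" if "t \<in> I" "\<xi> \<in> S" for t \<xi>
      by (intro DERIV_add f'(1) g'(1) that)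
  qed (rule Suc.IH[OF f'(2) g'(2)])
qed (auto simp: case_prod_unfold intro: continuous_on_add)

lemma smooth_upto_mult:
  "smooth_upto k I S f \<Longrightarrow> smooth_upto k I S g \<Longrightarrow> smooth_upto k I S (\<lambda>t \<xi>. f t \<xi> * g t \<xi>)"
proof (induction k arbitrary: f g)
  case (Suc k)
  obtain f' where f': "\<And>t \<xi>. t \<in> I \<Longrightarrow> \<xi> \<in> S \<Longrightarrow> ((\<lambda>t. f t \<xi>) has_real_derivative f' t \<xi>) (at t)"
    "smooth_upto k I S f'" using Suc.prems(1) by (rule smooth_upto_SucE) (rule that)
  obtain g' where g': "\<And>t \<xi>. t \<in> I \<Longrightarrow> \<xi> \<in> S \<Longrightarrow> ((\<lambda>t. g t \<xi>) has_real_derivative g' t \<xi>) (at t)"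
    "smooth_upto k I S g'" using Suc.prems(2) by (rule smooth_upto_SucE) (rule that)
  show ?case
  proof (rule smooth_upto_SucI)
    show "continuous_on (I \<times> S) (\<lambda>(t, \<xi>). f t \<xi> * g t \<xi>)"
      using Suc.prems[THEN smooth_upto_continuous] by (auto simp: case_prod_unfold intro: continuous_on_mult)
    show "((\<lambda>t. f t \<xi> * g t \<xi>) has_real_derivative f' t \<xi> * g t \<xi> + g' t \<xi> * f t \<xi>) (at t)"
      if "t \<in> I" "\<xi> \<in> S" for t \<xi>
      by (intro DERIV_mult f'(1) g'(1) that)
  qed (intro smooth_upto_add Suc.IH f'(2) g'(2) Suc.prems[THEN smooth_upto_Suc_imp])
qed (auto simp: case_prod_unfold intro: continuous_on_mult)

text \<open>The derivative contains the inverse again, but only smoothness of order \<open>k\<close>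
  is asked of it, which the induction hypothesis supplies. The square root works in the same
  way.\<close>

lemma smooth_upto_inverse:
  assumes "smooth_upto k I S f" "\<And>t \<xi>. t \<in> I \<Longrightarrow> \<xi> \<in> S \<Longrightarrow> f t \<xi> \<noteq> 0"
  shows "smooth_upto k I S (\<lambda>t \<xi>. inverse (f t \<xi>))"
  using assms
proof (induction k)
  case 0
  then show ?case by (force simp: case_prod_unfold intro!: continuous_on_inverse)
next
  case (Suc k)
  obtain f' where f': "\<And>t \<xi>. t \<in> I \<Longrightarrow> \<xi> \<in> S \<Longrightarrow> ((\<lambda>t. f t \<xi>) has_real_derivative f' t \<xi>) (at t)"
    "smooth_upto k I S f'" using Suc.prems(1) by (rule smooth_upto_SucE) (rule that)
  have inv: "smooth_upto k I S (\<lambda>t \<xi>. inverse (f t \<xi>))"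
    by (rule Suc.IH[OF smooth_upto_Suc_imp[OF Suc.prems(1)] Suc.prems(2)])
  show ?case
  proof (rule smooth_upto_SucI)
    show "continuous_on (I \<times> S) (\<lambda>(t, \<xi>). inverse (f t \<xi>))"
      using inv by (rule smooth_upto_continuous)
    show "((\<lambda>t. inverse (f t \<xi>)) has_real_derivative (- 1) * (f' t \<xi> * (inverse (f t \<xi>) * inverse (f t \<xi>)))) (at t)"
      if "t \<in> I" "\<xi> \<in> S" for t \<xi>
      using DERIV_inverse_fun[OF f'(1)[OF that] Suc.prems(2)[OF that]]
      by (simp add: power2_eq_square inverse_mult_distrib)
  qed (intro smooth_upto_mult smooth_upto_const f'(2) inv)
qed

lemma smooth_upto_sqrt:
  assumes "smooth_upto k I S f" "\<And>t \<xi>. t \<in> I \<Longrightarrow> \<xi> \<in> S \<Longrightarrow> 0 < f t \<xi>"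
  shows "smooth_upto k I S (\<lambda>t \<xi>. sqrt (f t \<xi>))"
  using assms
proof (induction k)
  case 0
  then show ?case by (force simp: case_prod_unfold intro!: continuous_on_real_sqrt)
next
  case (Suc k)
  obtain f' where f': "\<And>t \<xi>. t \<in> I \<Longrightarrow> \<xi> \<in> S \<Longrightarrow> ((\<lambda>t. f t \<xi>) has_real_derivative f' t \<xi>) (at t)"
    "smooth_upto k I S f'" using Suc.prems(1) by (rule smooth_upto_SucE) (rule that)
  have sq: "smooth_upto k I S (\<lambda>t \<xi>. sqrt (f t \<xi>))"
    by (rule Suc.IH[OF smooth_upto_Suc_imp[OF Suc.prems(1)] Suc.prems(2)])
  show ?case
  proof (rule smooth_upto_SucI)
    show "continuous_on (I \<times> S) (\<lambda>(t, \<xi>). sqrt (f t \<xi>))"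
      using sq by (rule smooth_upto_continuous)
    show "((\<lambda>t. sqrt (f t \<xi>)) has_real_derivative (1 / 2) * inverse (sqrt (f t \<xi>)) * f' t \<xi>) (at t)"
      if "t \<in> I" "\<xi> \<in> S" for t \<xi>
      using DERIV_chain2[OF DERIV_real_sqrt[OF Suc.prems(2)[OF that]] f'(1)[OF that]]
      by (simp add: field_simps)
    show "smooth_upto k I S (\<lambda>t \<xi>. (1 / 2) * inverse (sqrt (f t \<xi>)) * f' t \<xi>)"
    proof (intro smooth_upto_mult smooth_upto_inverse smooth_upto_const sq f'(2))
      show "sqrt (f t \<xi>) \<noteq> 0" if "t \<in> I" "\<xi> \<in> S" for t \<xi>
        using Suc.prems(2)[OF that] by simp
    qed
  qed
qed

lemma smooth_upto_sum:
  "(\<And>i. i \<in> A \<Longrightarrow> smooth_upto k I S (f i)) \<Longrightarrow> smooth_upto k I S (\<lambda>t \<xi>. \<Sum>i\<in>A. f i t \<xi>)"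
  by (induction A rule: infinite_finite_induct) (auto intro: smooth_upto_const smooth_upto_add)

lemma smooth_upto_prod_list:
  "(\<And>i. smooth_upto k I S (f i)) \<Longrightarrow> smooth_upto k I S (\<lambda>t \<xi>. \<Prod>i\<leftarrow>J. f i t \<xi>)"
  by (induction J) (auto intro: smooth_upto_const smooth_upto_mult)

lemma continuous_on_slice:
  assumes "continuous_on (I \<times> S) (\<lambda>(t, \<xi>). g t \<xi>)" "t \<in> I"
  shows "continuous_on S (g t)"
proof -
  have "continuous_on S ((\<lambda>(t, \<xi>). g t \<xi>) \<circ> (\<lambda>\<xi>. (t, \<xi>)))"
    using assms(2) by (intro continuous_on_compose continuous_intros continuous_on_subset[OF assms(1)]) auto
  then show ?thesis by (simp add: comp_def)
qed

lemma integrable_continuous_sphere: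
  fixes f :: "'a::euclidean_space \<Rightarrow> real"
  assumes "continuous_on (sphere 0 1) f"
  shows "integrable sphere_measure f"
proof -
  have "bounded (f ` sphere 0 1)"
    by (intro compact_imp_bounded compact_continuous_image assms compact_sphere)
  then obtain B where "\<forall>y \<in> f ` sphere 0 1. norm y \<le> B"
    unfolding bounded_iff by blast
  then have "\<bar>f \<xi>\<bar> \<le> B" if "norm \<xi> = 1" for \<xi>
    using that by simp
  then show ?thesis
    by (intro integrable_sphere_bounded continuous_on_measurable_sphere_measure assms)
qed

text \<open>Dominated convergence for the difference quotients. By the mean value theorem they are
  bounded by the maximum of \<open>g'\<close> over a compact interval times the sphere; restricting
  \<open>t\<close> to that interval makes this bound a constant, integrable for a finite
  measure.\<close>

lemma has_derivative_integral_sphere: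
  fixes g :: "real \<Rightarrow> 'a::euclidean_space \<Rightarrow> real"
  assumes "open I" "t0 \<in> I"
    and g: "continuous_on (I \<times> sphere 0 1) (\<lambda>(t, \<xi>). g t \<xi>)"
    and g': "continuous_on (I \<times> sphere 0 1) (\<lambda>(t, \<xi>). g' t \<xi>)"
    and deriv: "\<And>t \<xi>. t \<in> I \<Longrightarrow> \<xi> \<in> sphere 0 1 \<Longrightarrow> ((\<lambda>t. g t \<xi>) has_real_derivative g' t \<xi>) (at t)"
  shows "((\<lambda>t. LINT \<xi>|sphere_measure. g t \<xi>) has_real_derivative (LINT \<xi>|sphere_measure. g' t0 \<xi>)) (at t0)"
proof -
  obtain e where e: "0 < e" "cball t0 e \<subseteq> I"
    using assms(1,2) open_contains_cball by blast
  have "compact ((\<lambda>(t, \<xi>). g' t \<xi>) ` (cball t0 e \<times> sphere 0 1))"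
    using e by (intro compact_continuous_image compact_Times compact_cball compact_sphere
        continuous_on_subset[OF g']) auto
  then have "bounded ((\<lambda>(t, \<xi>). g' t \<xi>) ` (cball t0 e \<times> sphere 0 1))"
    by (rule compact_imp_bounded)
  then obtain B where B: "\<And>t \<xi>. t \<in> cball t0 e \<Longrightarrow> norm \<xi> = 1 \<Longrightarrow> \<bar>g' t \<xi>\<bar> \<le> B"
    unfolding bounded_iff by fastforce
  have lip: "\<bar>g t \<xi> - g t0 \<xi>\<bar> \<le> B * \<bar>t - t0\<bar>" if "t \<in> cball t0 e" "norm \<xi> = 1" for t \<xi>
  proof -
    have "norm (g t \<xi> - g t0 \<xi>) \<le> B * norm (t - t0)"
    proof (rule field_differentiable_bound[of "cball t0 e" "\<lambda>t. g t \<xi>" "\<lambda>t. g' t \<xi>"])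
      show "((\<lambda>t. g t \<xi>) has_field_derivative g' s \<xi>) (at s within cball t0 e)" if "s \<in> cball t0 e" for s
        by (rule has_field_derivative_at_within[OF deriv[OF subsetD[OF e(2) that]]])
          (simp add: \<open>norm \<xi> = 1\<close>)
      show "norm (g' s \<xi>) \<le> B" if "s \<in> cball t0 e" for s
        using B[OF that \<open>norm \<xi> = 1\<close>] by simp
    qed (use that(1) \<open>0 < e\<close> in simp_all)
    then show ?thesis by simp
  qed
  have int: "integrable sphere_measure (g t)" if "t \<in> I" for t
    by (rule integrable_continuous_sphere[OF continuous_on_slice[OF g that]])
  have m': "g' t0 \<in> borel_measurable sphere_measure"
    by (rule continuous_on_measurable_sphere_measure[OF continuous_on_slice[OF g' assms(2)]])
  have "((\<lambda>t. LINT \<xi>|sphere_measure. g t \<xi>) has_real_derivative (LINT \<xi>|sphere_measure. g' t0 \<xi>)) (at t0 within cball t0 e)"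
    unfolding has_field_derivative_iff tendsto_at_iff_sequentially
  proof (intro allI impI)
    fix X assume X: "\<forall>i. X i \<in> cball t0 e - {t0}" "X \<longlonglongrightarrow> t0"
    have X0: "X i \<in> cball t0 e" "X i \<noteq> t0" "X i \<in> I" for i using X(1) e by auto
    have "(\<lambda>i. LINT \<xi>|sphere_measure. (g (X i) \<xi> - g t0 \<xi>) / (X i - t0)) \<longlonglongrightarrow> (LINT \<xi>|sphere_measure. g' t0 \<xi>)"
    proof (rule integral_dominated_convergence[where w = "\<lambda>_. B"])
      show "(\<lambda>\<xi>. (g (X i) \<xi> - g t0 \<xi>) / (X i - t0)) \<in> borel_measurable sphere_measure" for i
        using borel_measurable_integrable[OF int[OF X0(3)]] borel_measurable_integrable[OF int[OF assms(2)]]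
        by simp
      show "AE \<xi> in sphere_measure. (\<lambda>i. (g (X i) \<xi> - g t0 \<xi>) / (X i - t0)) \<longlonglongrightarrow> g' t0 \<xi>"
      proof (rule AE_I2)
        fix \<xi> :: 'a assume "\<xi> \<in> space sphere_measure"
        then have "((\<lambda>t. (g t \<xi> - g t0 \<xi>) / (t - t0)) \<longlongrightarrow> g' t0 \<xi>) (at t0)"
          using deriv[OF assms(2), of \<xi>] by (simp add: has_field_derivative_iff)
        then show "(\<lambda>i. (g (X i) \<xi> - g t0 \<xi>) / (X i - t0)) \<longlonglongrightarrow> g' t0 \<xi>"
          using X(2) X0(2) unfolding tendsto_at_iff_sequentially comp_def by auto
      qed
      show "AE \<xi> in sphere_measure. norm ((g (X i) \<xi> - g t0 \<xi>) / (X i - t0)) \<le> B" for i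
      proof (rule AE_I2)
        fix \<xi> :: 'a assume "\<xi> \<in> space sphere_measure"
        then have "\<bar>g (X i) \<xi> - g t0 \<xi>\<bar> \<le> B * \<bar>X i - t0\<bar>" by (intro lip X0) simp
        then show "norm ((g (X i) \<xi> - g t0 \<xi>) / (X i - t0)) \<le> B"
          using X0(2)[of i] by (simp add: pos_divide_le_eq)
      qed
    qed (use m' in simp_all)
    moreover have "(LINT \<xi>|sphere_measure. (g (X i) \<xi> - g t0 \<xi>) / (X i - t0))
        = ((LINT \<xi>|sphere_measure. g (X i) \<xi>) - (LINT \<xi>|sphere_measure. g t0 \<xi>)) / (X i - t0)" for i
      using int[OF X0(3)[of i]] int[OF assms(2)] by simp
    ultimately show "((\<lambda>t. ((LINT \<xi>|sphere_measure. g t \<xi>) - (LINT \<xi>|sphere_measure. g t0 \<xi>)) / (t - t0)) \<circ> X)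
        \<longlonglongrightarrow> (LINT \<xi>|sphere_measure. g' t0 \<xi>)"
      by (simp only: comp_def)
  qed
  moreover have "at t0 within cball t0 e = at t0"
    using e by (intro at_within_interior) (simp add: interior_cball)
  ultimately show ?thesis by simp
qed

subsection \<open>The fundamental solution\<close>

definition weighted_projection :: "(real^'n \<Rightarrow> real) \<Rightarrow> real^'n \<Rightarrow> real" where
  "weighted_projection Q z = (LINT \<xi>|sphere_measure. \<bar>z \<bullet> \<xi>\<bar> / Q \<xi>)"

lemma continuous_on_prod_list:
  fixes f :: "'i \<Rightarrow> 'a::topological_space \<Rightarrow> real"
  shows "(\<And>i. continuous_on S (f i)) \<Longrightarrow> continuous_on S (\<lambda>x. \<Prod>i\<leftarrow>J. f i x)"
  by (induction J) (auto intro: continuous_on_mult)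

lemma continuous_on_homogeneous_form: "continuous_on S (homogeneous_form m A)"
  unfolding homogeneous_form_def
  by (intro continuous_intros continuous_on_prod_list)

lemma smooth_upto_homogeneous_form:
  assumes "\<And>j. smooth_upto k I S (\<lambda>t \<xi>. X t \<xi> $ j)"
  shows "smooth_upto k I S (\<lambda>t \<xi>. homogeneous_form m A (X t \<xi>))"
  unfolding homogeneous_form_def
  by (intro smooth_upto_sum smooth_upto_mult smooth_upto_const smooth_upto_prod_list assms)

lemma smooth_upto_inner:
  fixes X Y :: "real \<Rightarrow> 'a::topological_space \<Rightarrow> real^'n"
  assumes "\<And>j. smooth_upto k I S (\<lambda>t \<xi>. X t \<xi> $ j)" "\<And>j. smooth_upto k I S (\<lambda>t \<xi>. Y t \<xi> $ j)"
  shows "smooth_upto k I S (\<lambda>t \<xi>. X t \<xi> \<bullet> Y t \<xi>)"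
  unfolding inner_vec_def inner_real_def
  by (intro smooth_upto_sum smooth_upto_mult assms)

text \<open>
  The reflection along \<open>y + |y| p\<close> maps \<open>y\<close> to \<open>- |y| p\<close>. Substituting it moves the
  dependence on \<open>y\<close> from the kink of the absolute value into the smooth weight.
\<close>

lemma weighted_projection_reflect:
  assumes "continuous_on (sphere 0 1) Q" "\<And>\<xi>. norm \<xi> = 1 \<Longrightarrow> 0 < Q \<xi>" "norm p = 1"
  shows "weighted_projection Q y
    = (LINT \<xi>|sphere_measure. norm y * (\<bar>p \<bullet> \<xi>\<bar> * inverse (Q (reflect (y + norm y *\<^sub>R p) \<xi>))))"
proof -
  let ?w = "y + norm y *\<^sub>R p"
  have w: "reflect ?w y = - (norm y *\<^sub>R p)"
    using reflect_swap[of y "- (norm y *\<^sub>R p)"] \<open>norm p = 1\<close> by simp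
  have "continuous_on (sphere 0 1) (\<lambda>\<xi>. \<bar>y \<bullet> \<xi>\<bar> / Q \<xi>)"
    using assms(2) by (intro continuous_intros assms(1)) force
  then have "weighted_projection Q y
      = (LINT \<xi>|sphere_measure. \<bar>y \<bullet> reflect ?w \<xi>\<bar> / Q (reflect ?w \<xi>))"
    unfolding weighted_projection_def
    by (intro integral_reflect_sphere[symmetric] continuous_on_measurable_sphere_measure)
  then show ?thesis
    by (simp add: inner_reflect w abs_mult divide_inverse mult.assoc)
qed

lemma weighted_projection_line_derivatives:
  fixes z e :: "real^'n"
  assumes Q: "Q = homogeneous_form m A" "\<And>\<xi>. norm \<xi> = 1 \<Longrightarrow> 0 < Q \<xi>"
    and "z \<noteq> 0" "norm e = 1"
  obtains f' D where
    "\<And>t. \<bar>t\<bar> < norm z \<Longrightarrow> ((\<lambda>t. weighted_projection Q (z + t *\<^sub>R e)) has_real_derivative f' t) (at t)"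
    "(f' has_real_derivative D) (at 0)"
proof -
  define I where "I = {- norm z <..< norm z}"
  define p where "p = z /\<^sub>R norm z"
  define y where "y t = z + t *\<^sub>R e" for t
  \<comment> \<open>The target is \<open>- p\<close> with \<open>p\<close> the direction of
    \<open>z\<close>, because \<open>y t - norm (y t) *\<^sub>R p\<close> would vanish at
    \<open>t = 0\<close>. For \<open>\<bar>t\<bar> < norm z\<close> the vector \<open>y t\<close>
    keeps a positive component along \<open>p\<close>, so \<open>w t\<close> never vanishes and the
    reflection depends smoothly on \<open>t\<close>.\<close>
  define w where "w t = y t + norm (y t) *\<^sub>R p" for t
  define g where "g t \<xi> = norm (y t) * (\<bar>p \<bullet> \<xi>\<bar> * inverse (Q (reflect (w t) \<xi>)))" for t \<xi>
  have "norm p = 1" using \<open>z \<noteq> 0\<close> by (simp add: p_def)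
  have yp: "0 < y t \<bullet> p" if "t \<in> I" for t
  proof -
    have "z \<bullet> p = norm z" using \<open>z \<noteq> 0\<close> by (simp add: p_def dot_square_norm power2_eq_square)
    moreover have "\<bar>e \<bullet> p\<bar> \<le> 1"
      using Cauchy_Schwarz_ineq2[of e p] \<open>norm e = 1\<close> \<open>norm p = 1\<close> by simp
    then have "\<bar>t * (e \<bullet> p)\<bar> \<le> \<bar>t\<bar>" by (simp add: abs_mult mult_left_le)
    ultimately show ?thesis
      using that by (auto simp: y_def I_def inner_add_left)
  qed
  have y0: "y t \<noteq> 0" if "t \<in> I" for t using yp[OF that] by auto
  have w0: "w t \<noteq> 0" if "t \<in> I" for t
  proof
    assume "w t = 0"
    then have "w t \<bullet> p = 0" by simp
    moreover have "w t \<bullet> p = y t \<bullet> p + norm (y t)"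
      using \<open>norm p = 1\<close> by (simp add: w_def inner_add_left dot_square_norm)
    ultimately show False using yp[OF that] norm_ge_zero[of "y t"] by linarith
  qed
  have sy: "smooth_upto 2 I (sphere 0 1) (\<lambda>t \<xi>. y t $ j)" for j
    unfolding y_def vector_add_component vector_scaleR_component real_scaleR_def
    by (intro smooth_upto_add smooth_upto_mult smooth_upto_const smooth_upto_id)
  have sn: "smooth_upto 2 I (sphere 0 1) (\<lambda>t \<xi>. norm (y t))"
    unfolding norm_eq_sqrt_inner
  proof (intro smooth_upto_sqrt smooth_upto_inner sy)
    show "0 < y t \<bullet> y t" if "t \<in> I" for t
      using y0[OF that] by simp
  qed
  have sw: "smooth_upto 2 I (sphere 0 1) (\<lambda>t \<xi>. w t $ j)" for j
    unfolding w_def vector_add_component vector_scaleR_component real_scaleR_def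
    by (intro smooth_upto_add smooth_upto_mult smooth_upto_const sy sn)
  have sx: "smooth_upto 2 I (sphere 0 1) (\<lambda>t (\<xi>::real^'n). \<xi> $ j)" for j
    by (intro smooth_upto_param continuous_intros)
  have sr: "smooth_upto 2 I (sphere 0 1) (\<lambda>t \<xi>. reflect (w t) \<xi> $ j)" for j
  proof -
    have "smooth_upto 2 I (sphere 0 1)
        (\<lambda>t \<xi>. \<xi> $ j + (- 1) * (2 * (w t \<bullet> \<xi>) * inverse (w t \<bullet> w t) * w t $ j))"
    proof (intro smooth_upto_add smooth_upto_mult smooth_upto_const smooth_upto_inverse smooth_upto_inner sx sw)
      show "w t \<bullet> w t \<noteq> 0" if "t \<in> I" for t
        using w0[OF that] by simp
    qed
    then show ?thesis by (simp add: reflect_def divide_inverse)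
  qed
  have sQ: "smooth_upto 2 I (sphere 0 1) (\<lambda>t \<xi>. Q (reflect (w t) \<xi>))"
    unfolding Q(1) by (intro smooth_upto_homogeneous_form sr)
  have Qr: "Q (reflect (w t) \<xi>) \<noteq> 0" if "\<xi> \<in> sphere 0 1" for t \<xi>
    using Q(2)[of "reflect (w t) \<xi>"] that by simp
  have sp: "smooth_upto 2 I (sphere 0 1) (\<lambda>t \<xi>. \<bar>p \<bullet> \<xi>\<bar>)"
    by (intro smooth_upto_param continuous_intros)
  have sg: "smooth_upto (Suc (Suc 0)) I (sphere 0 1) g"
    using smooth_upto_mult[OF sn smooth_upto_mult[OF sp smooth_upto_inverse[OF sQ Qr]]]
    unfolding g_def[abs_def] numeral_2_eq_2 .
  have F: "weighted_projection Q (y t) = (LINT \<xi>|sphere_measure. g t \<xi>)" for t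
    unfolding g_def w_def using Q \<open>norm p = 1\<close> continuous_on_homogeneous_form
    by (intro weighted_projection_reflect) auto
  obtain g1 where g1: "\<And>t \<xi>. t \<in> I \<Longrightarrow> \<xi> \<in> sphere 0 1 \<Longrightarrow> ((\<lambda>t. g t \<xi>) has_real_derivative g1 t \<xi>) (at t)"
    "smooth_upto (Suc 0) I (sphere 0 1) g1" using sg by (rule smooth_upto_SucE) (rule that)
  obtain g2 where g2: "\<And>t \<xi>. t \<in> I \<Longrightarrow> \<xi> \<in> sphere 0 1 \<Longrightarrow> ((\<lambda>t. g1 t \<xi>) has_real_derivative g2 t \<xi>) (at t)"
    "smooth_upto 0 I (sphere 0 1) g2" using g1(2) by (rule smooth_upto_SucE) (rule that)
  have "open I" by (simp add: I_def)
  show ?thesis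
  proof (rule that)
    fix t assume "\<bar>t\<bar> < norm z"
    then have "t \<in> I" by (auto simp: I_def)
    have "((\<lambda>t. LINT \<xi>|sphere_measure. g t \<xi>) has_real_derivative (LINT \<xi>|sphere_measure. g1 t \<xi>)) (at t)"
      by (rule has_derivative_integral_sphere[OF \<open>open I\<close> \<open>t \<in> I\<close> smooth_upto_continuous[OF sg]
            smooth_upto_continuous[OF g1(2)] g1(1)])
    then show "((\<lambda>t. weighted_projection Q (z + t *\<^sub>R e)) has_real_derivative (LINT \<xi>|sphere_measure. g1 t \<xi>)) (at t)"
      unfolding F[symmetric] y_def .
  next
    have "0 \<in> I" using \<open>z \<noteq> 0\<close> by (simp add: I_def)
    show "((\<lambda>t. LINT \<xi>|sphere_measure. g1 t \<xi>) has_real_derivative (LINT \<xi>|sphere_measure. g2 0 \<xi>)) (at 0)"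
      by (rule has_derivative_integral_sphere[OF \<open>open I\<close> \<open>0 \<in> I\<close> smooth_upto_continuous[OF g1(2)]
            smooth_upto_continuous[OF g2(2)] g2(1)])
  qed
qed

section \<open>Lower bounds for second derivatives and for the Laplacian\<close>

lemma convex_on_abs_line_inner: "convex_on UNIV (\<lambda>t. \<bar>(z + t *\<^sub>R e) \<bullet> \<xi>\<bar>)"
proof (rule convex_onI)
  fix u a b :: real assume u: "0 < u" "u < 1"
  have "(z + ((1 - u) *\<^sub>R a + u *\<^sub>R b) *\<^sub>R e) \<bullet> \<xi> = (1 - u) * ((z + a *\<^sub>R e) \<bullet> \<xi>) + u * ((z + b *\<^sub>R e) \<bullet> \<xi>)"
    by (simp add: inner_add_left algebra_simps)
  also have "\<bar>\<dots>\<bar> \<le> (1 - u) * \<bar>(z + a *\<^sub>R e) \<bullet> \<xi>\<bar> + u * \<bar>(z + b *\<^sub>R e) \<bullet> \<xi>\<bar>"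
    using u by (intro order_trans[OF abs_triangle_ineq]) (simp add: abs_mult)
  finally show "\<bar>(z + ((1 - u) *\<^sub>R a + u *\<^sub>R b) *\<^sub>R e) \<bullet> \<xi>\<bar>
      \<le> (1 - u) * \<bar>(z + a *\<^sub>R e) \<bullet> \<xi>\<bar> + u * \<bar>(z + b *\<^sub>R e) \<bullet> \<xi>\<bar>" .
qed simp

text \<open>Adding the tangent inequalities at \<open>s\<close> and at \<open>t\<close> shows that
  \<open>f'\<close> is increasing near 0.\<close>

lemma convex_on_second_derivative_nonneg:
  fixes f :: "real \<Rightarrow> real"
  assumes conv: "convex_on UNIV f" and "0 < r"
    and f': "\<And>t. \<bar>t\<bar> < r \<Longrightarrow> (f has_real_derivative f' t) (at t)"
    and D: "(f' has_real_derivative D) (at 0)"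
  shows "0 \<le> D"
proof (rule mono_on_imp_deriv_nonneg[OF _ D])
  show "mono_on {-r<..<r} f'"
  proof (rule mono_onI)
    fix s t assume st: "s \<in> {-r<..<r}" "t \<in> {-r<..<r}" "s \<le> t"
    have "f' s * (t - s) \<le> f t - f s" "f' t * (s - t) \<le> f s - f t"
      using st by (auto intro!: convex_on_imp_above_tangent[OF conv] f')
    then have "f' s * (t - s) \<le> f' t * (t - s)" by (simp add: algebra_simps)
    then show "f' s \<le> f' t" using \<open>s \<le> t\<close> by (cases "s = t") auto
  qed
qed (use \<open>0 < r\<close> in simp)

lemma norm_line_derivative:
  fixes z e :: "'a::real_inner"
  assumes "norm e = 1" "\<bar>t\<bar> < norm z"
  shows "((\<lambda>t. norm (z + t *\<^sub>R e)) has_real_derivative (z \<bullet> e + t) / norm (z + t *\<^sub>R e)) (at t)"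
proof -
  have eq: "norm (z + s *\<^sub>R e) = sqrt (z \<bullet> z + 2 * s * (z \<bullet> e) + s\<^sup>2)" for s
    using \<open>norm e = 1\<close>
    by (simp add: norm_eq_sqrt_inner inner_add_left inner_add_right inner_commute power2_eq_square algebra_simps)
  have "norm (t *\<^sub>R e) < norm z" using assms by simp
  moreover have "norm z \<le> norm (z + t *\<^sub>R e) + norm (t *\<^sub>R e)"
    using norm_triangle_ineq4[of "z + t *\<^sub>R e" "t *\<^sub>R e"] by simp
  ultimately have "0 < norm (z + t *\<^sub>R e)" by linarith
  then have pos: "0 < z \<bullet> z + 2 * t * (z \<bullet> e) + t\<^sup>2" unfolding eq by simp
  have "((\<lambda>t. sqrt (z \<bullet> z + 2 * t * (z \<bullet> e) + t\<^sup>2)) has_real_derivative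
      (z \<bullet> e + t) / sqrt (z \<bullet> z + 2 * t * (z \<bullet> e) + t\<^sup>2)) (at t)"
    using pos by (auto intro!: derivative_eq_intros simp: field_simps)
  then show ?thesis unfolding eq .
qed

lemma norm_line_second_derivative:
  fixes z e :: "'a::real_inner"
  assumes "norm e = 1" "z \<noteq> 0"
  shows "((\<lambda>t. (z \<bullet> e + t) / norm (z + t *\<^sub>R e)) has_real_derivative
    1 / norm z - (z \<bullet> e)\<^sup>2 / norm z ^ 3) (at 0)"
proof -
  have "((\<lambda>t. (z \<bullet> e + t) / norm (z + t *\<^sub>R e)) has_real_derivative
    (1 * norm (z + 0 *\<^sub>R e) - (z \<bullet> e + 0) * ((z \<bullet> e + 0) / norm (z + 0 *\<^sub>R e)))
      / (norm (z + 0 *\<^sub>R e) * norm (z + 0 *\<^sub>R e))) (at 0)"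
    using assms by (intro DERIV_divide norm_line_derivative) (auto intro!: derivative_eq_intros)
  moreover have "(1 * norm (z + 0 *\<^sub>R e) - (z \<bullet> e + 0) * ((z \<bullet> e + 0) / norm (z + 0 *\<^sub>R e)))
      / (norm (z + 0 *\<^sub>R e) * norm (z + 0 *\<^sub>R e)) = 1 / norm z - (z \<bullet> e)\<^sup>2 / norm z ^ 3"
    using assms by (simp add: field_simps power2_eq_square power3_eq_cube)
  ultimately show ?thesis by simp
qed

text \<open>
  Subtracting the constant weight \<open>1/\<Lambda> \<le> 1/Q\<close> leaves a convex function, and the projection with
  constant weight is a multiple of the norm by rotation invariance.
\<close>

lemma weighted_projection_second_derivative_ge:
  fixes z e :: "real^'n"
  assumes Q: "continuous_on (sphere 0 1) Q" "\<And>\<xi>. norm \<xi> = 1 \<Longrightarrow> 0 < Q \<xi>"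
    and \<Lambda>: "0 < \<Lambda>" "\<And>\<xi>. norm \<xi> = 1 \<Longrightarrow> Q \<xi> \<le> \<Lambda>"
    and "z \<noteq> 0" "norm e = 1"
    and f': "\<And>t. \<bar>t\<bar> < norm z \<Longrightarrow> ((\<lambda>t. weighted_projection Q (z + t *\<^sub>R e)) has_real_derivative f' t) (at t)"
    and D: "(f' has_real_derivative D) (at 0)"
  shows "mean_projection TYPE(real^'n) / \<Lambda> * (1 / norm z - (z \<bullet> e)\<^sup>2 / norm z ^ 3) \<le> D"
proof -
  \<comment> \<open>With this value \<open>\<kappa> * norm y\<close> is the projection integral with
    constant weight \<open>1 / \<Lambda>\<close>.\<close>
  define \<kappa> where "\<kappa> = mean_projection TYPE(real^'n) / \<Lambda>"
  define F where "F t = weighted_projection Q (z + t *\<^sub>R e) - \<kappa> * norm (z + t *\<^sub>R e)" for t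
  define W where "W \<xi> = 1 / Q \<xi> - 1 / \<Lambda>" for \<xi>
  have W0: "0 \<le> W \<xi>" if "norm \<xi> = 1" for \<xi>
    using Q(2)[OF that] \<Lambda>(2)[OF that] by (simp add: W_def frac_le)
  have cW: "continuous_on (sphere 0 1) W"
    unfolding W_def using Q(2) \<Lambda>(1) by (intro continuous_intros Q(1)) force+
  have int: "integrable sphere_measure (\<lambda>\<xi>. \<bar>y \<bullet> \<xi>\<bar> * W \<xi>)" for y
    by (intro integrable_continuous_sphere continuous_intros cW)
  have int1: "integrable sphere_measure (\<lambda>\<xi>. \<bar>y \<bullet> \<xi>\<bar> / Q \<xi>)" for y
    using Q(2) by (intro integrable_continuous_sphere continuous_intros Q(1)) force
  have int2: "integrable sphere_measure (\<lambda>\<xi>. \<bar>y \<bullet> \<xi>\<bar> / \<Lambda>)" for y :: "real^'n"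
    by (intro integrable_divide integrable_abs_inner)
  have F: "F t = (LINT \<xi>|sphere_measure. \<bar>(z + t *\<^sub>R e) \<bullet> \<xi>\<bar> * W \<xi>)" for t
  proof -
    have "\<kappa> * norm (z + t *\<^sub>R e) = (LINT \<xi>|sphere_measure. \<bar>(z + t *\<^sub>R e) \<bullet> \<xi>\<bar> / \<Lambda>)"
      by (simp add: \<kappa>_def integral_abs_inner)
    then have "F t = (LINT \<xi>|sphere_measure. \<bar>(z + t *\<^sub>R e) \<bullet> \<xi>\<bar> / Q \<xi> - \<bar>(z + t *\<^sub>R e) \<bullet> \<xi>\<bar> / \<Lambda>)"
      unfolding F_def weighted_projection_def by (simp add: Bochner_Integration.integral_diff[OF int1 int2])
    then show ?thesis by (simp add: W_def right_diff_distrib)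
  qed
  have "convex_on UNIV F"
  proof (rule convex_onI)
    fix u a b :: real assume u: "0 < u" "u < 1"
    let ?h = "\<lambda>t \<xi>. \<bar>(z + t *\<^sub>R e) \<bullet> \<xi>\<bar> * W \<xi>"
    have "F ((1 - u) *\<^sub>R a + u *\<^sub>R b) \<le> (LINT \<xi>|sphere_measure. (1 - u) * ?h a \<xi> + u * ?h b \<xi>)"
      unfolding F
    proof (rule integral_mono)
      fix \<xi> :: "real^'n" assume "\<xi> \<in> space sphere_measure"
      then have "\<bar>(z + ((1 - u) *\<^sub>R a + u *\<^sub>R b) *\<^sub>R e) \<bullet> \<xi>\<bar> * W \<xi>
          \<le> ((1 - u) * \<bar>(z + a *\<^sub>R e) \<bullet> \<xi>\<bar> + u * \<bar>(z + b *\<^sub>R e) \<bullet> \<xi>\<bar>) * W \<xi>"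
        using u convex_onD[OF convex_on_abs_line_inner[of z e \<xi>], of u a b]
        by (intro mult_right_mono W0) auto
      then show "?h ((1 - u) *\<^sub>R a + u *\<^sub>R b) \<xi> \<le> (1 - u) * ?h a \<xi> + u * ?h b \<xi>"
        by (simp add: algebra_simps)
    qed (intro int Bochner_Integration.integrable_add integrable_mult_right)+
    also have "\<dots> = (1 - u) * F a + u * F b"
      unfolding F by (subst Bochner_Integration.integral_add) (use int in simp_all)
    finally show "F ((1 - u) *\<^sub>R a + u *\<^sub>R b) \<le> (1 - u) * F a + u * F b" .
  qed simp
  then have "0 \<le> D - \<kappa> * (1 / norm z - (z \<bullet> e)\<^sup>2 / norm z ^ 3)"
  proof (rule convex_on_second_derivative_nonneg)
    show "0 < norm z" using \<open>z \<noteq> 0\<close> by simp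
    show "(F has_real_derivative f' t - \<kappa> * ((z \<bullet> e + t) / norm (z + t *\<^sub>R e))) (at t)"
      if "\<bar>t\<bar> < norm z" for t
      unfolding F_def[abs_def] by (intro DERIV_diff DERIV_cmult f' norm_line_derivative that \<open>norm e = 1\<close>)
    show "((\<lambda>t. f' t - \<kappa> * ((z \<bullet> e + t) / norm (z + t *\<^sub>R e))) has_real_derivative
        D - \<kappa> * (1 / norm z - (z \<bullet> e)\<^sup>2 / norm z ^ 3)) (at 0)"
      by (intro DERIV_diff DERIV_cmult D norm_line_second_derivative \<open>norm e = 1\<close> \<open>z \<noteq> 0\<close>)
  qed
  then show ?thesis by (simp add: \<kappa>_def)
qed

text \<open>The outer derivative sees the inner one on a whole interval of the line, so
  \<open>f'\<close> must be identified with it for all small \<open>s\<close>, not just at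
  0.\<close>

lemma second_partial_deriv_eqI:
  assumes "0 < r"
    and f': "\<And>t. \<bar>t\<bar> < r \<Longrightarrow> ((\<lambda>t. u (y + t *\<^sub>R axis i 1)) has_real_derivative f' t) (at t)"
    and D: "(f' has_real_derivative D) (at 0)"
  shows "partial_deriv i (partial_deriv i u) y = D"
proof -
  have eq: "partial_deriv i u (y + s *\<^sub>R axis i 1) = f' s" if "\<bar>s\<bar> < r" for s
  proof -
    have "((\<lambda>t. u (y + (s + t) *\<^sub>R axis i 1)) has_real_derivative f' s) (at 0)"
      using f'[OF that] DERIV_shift[of "\<lambda>t. u (y + t *\<^sub>R axis i 1)" "f' s" 0 s]
      by (simp add: add.commute)
    then have "((\<lambda>t. u (y + s *\<^sub>R axis i 1 + t *\<^sub>R axis i 1)) has_real_derivative f' s) (at 0)"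
      by (simp add: scaleR_add_left add.assoc)
    then show ?thesis unfolding partial_deriv_def by (rule DERIV_imp_deriv)
  qed
  have "((\<lambda>s. partial_deriv i u (y + s *\<^sub>R axis i 1)) has_real_derivative D) (at 0)"
  proof (rule has_field_derivative_transform_within_open[OF D])
    show "open {-r<..<r}" "0 \<in> {-r<..<r}" using \<open>0 < r\<close> by auto
    show "f' s = partial_deriv i u (y + s *\<^sub>R axis i 1)" if "s \<in> {-r<..<r}" for s
      using eq[of s] that by auto
  qed
  then show ?thesis unfolding partial_deriv_def[of i "partial_deriv i u"] by (rule DERIV_imp_deriv)
qed

lemma weighted_projection_minus: "weighted_projection Q (- z) = weighted_projection Q z"
  by (simp add: weighted_projection_def)

lemma elliptic_pos_on_sphere:
  assumes "uniformly_elliptic m Q" "norm \<xi> = 1"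
  shows "0 < Q \<xi>"
proof -
  obtain c where "0 < c" "c * norm \<xi> ^ (2 * m) \<le> Q \<xi>"
    using assms(1) unfolding uniformly_elliptic_def by blast
  then show ?thesis using assms(2) by simp
qed

lemma neg_laplacian_weighted_projection_neg:
  fixes x y :: "real^'n"
  assumes Q: "Q = homogeneous_form m A" and ell: "uniformly_elliptic m Q"
    and "x \<noteq> y" and n: "CARD('n) \<ge> 2"
  shows "neg_laplacian (\<lambda>y. weighted_projection Q (x - y)) y < 0"
proof -
  \<comment> \<open>The derivatives are taken in \<open>y\<close>, while \<open>x - y\<close>
    enters. As the projection is even, the sign can be turned, and a line through \<open>y\<close>
    becomes a line through \<open>z\<close> with the same direction.\<close>
  define z where "z = y - x"
  define u where "u = (\<lambda>y. weighted_projection Q (x - y))"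
  have "z \<noteq> 0" using \<open>x \<noteq> y\<close> by (simp add: z_def)
  have pos: "0 < Q \<xi>" if "norm \<xi> = 1" for \<xi> using elliptic_pos_on_sphere[OF ell that] .
  have cont: "continuous_on (sphere 0 1) Q" unfolding Q by (rule continuous_on_homogeneous_form)
  have "bounded (Q ` sphere 0 1)"
    by (intro compact_imp_bounded compact_continuous_image cont compact_sphere)
  then obtain B where B: "\<forall>q \<in> Q ` sphere 0 1. norm q \<le> B" unfolding bounded_iff by blast
  \<comment> \<open>The maximum with 1 merely makes positivity immediate.\<close>
  define \<Lambda> where "\<Lambda> = max B 1"
  have Q_le: "Q \<xi> \<le> \<Lambda>" if "norm \<xi> = 1" for \<xi>
  proof -
    have "\<bar>Q \<xi>\<bar> \<le> B" using B that by simp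
    then show ?thesis by (simp add: \<Lambda>_def)
  qed
  have "0 < \<Lambda>" by (simp add: \<Lambda>_def)
  define \<kappa> where "\<kappa> = mean_projection TYPE(real^'n) / \<Lambda>"
  have "0 < \<kappa>" using mean_projection_pos[where 'a = "real^'n"] n \<open>0 < \<Lambda>\<close> by (simp add: \<kappa>_def)
  have line: "u (y + t *\<^sub>R e) = weighted_projection Q (z + t *\<^sub>R e)" for t e
    using weighted_projection_minus[of Q "z + t *\<^sub>R e"] by (simp add: u_def z_def algebra_simps)
  have D: "\<kappa> * (1 / norm z - (z $ i)\<^sup>2 / norm z ^ 3) \<le> partial_deriv i (partial_deriv i u) y" for i
  proof -
    have "norm (axis i 1 :: real^'n) = 1" by simp
    obtain f' D where fD:
      "\<And>t. \<bar>t\<bar> < norm z \<Longrightarrow> ((\<lambda>t. weighted_projection Q (z + t *\<^sub>R axis i 1)) has_real_derivative f' t) (at t)"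
      "(f' has_real_derivative D) (at 0)"
      by (rule weighted_projection_line_derivatives[OF Q pos \<open>z \<noteq> 0\<close> \<open>norm (axis i 1) = 1\<close>])
        (assumption, rule that)
    have "partial_deriv i (partial_deriv i u) y = D"
      using \<open>z \<noteq> 0\<close> fD by (intro second_partial_deriv_eqI[of "norm z" u y i f']) (simp_all add: line)
    moreover have "\<kappa> * (1 / norm z - (z \<bullet> axis i 1)\<^sup>2 / norm z ^ 3) \<le> D"
      unfolding \<kappa>_def
      by (rule weighted_projection_second_derivative_ge[OF cont pos \<open>0 < \<Lambda>\<close> Q_le \<open>z \<noteq> 0\<close> \<open>norm (axis i 1) = 1\<close> fD])
    ultimately show ?thesis by (simp add: inner_axis)
  qed
  have "(norm z)\<^sup>2 = (\<Sum>i\<in>UNIV. (z $ i)\<^sup>2)"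
    unfolding power2_norm_eq_inner inner_vec_def by (simp add: power2_eq_square)
  then have "(\<Sum>i\<in>UNIV. \<kappa> * (1 / norm z - (z $ i)\<^sup>2 / norm z ^ 3))
      = \<kappa> * (real CARD('n) / norm z - (norm z)\<^sup>2 / norm z ^ 3)"
    by (simp add: sum_subtractf flip: sum_distrib_left sum_divide_distrib)
  also have "\<dots> = \<kappa> * ((real CARD('n) - 1) / norm z)"
    using \<open>z \<noteq> 0\<close> by (simp add: power2_eq_square power3_eq_cube diff_divide_distrib)
  also have "0 < \<dots>" using \<open>0 < \<kappa>\<close> n \<open>z \<noteq> 0\<close> by simp
  finally have "0 < (\<Sum>i\<in>UNIV. partial_deriv i (partial_deriv i u) y)"
    using sum_mono[of UNIV "\<lambda>i. \<kappa> * (1 / norm z - (z $ i)\<^sup>2 / norm z ^ 3)", OF D] by linarith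
  then show ?thesis unfolding neg_laplacian_def u_def by simp
qed

section \<open>The sign of the logarithmic integral\<close>

text \<open>The integrand has a sign, so by integrability the integral could vanish only if
  \<open>z \<bullet> \<xi>\<close> were 0 almost everywhere. Then \<open>mean_projection\<close>
  would be 0.\<close>

lemma integral_ln_abs_inner_neg:
  fixes z :: "real^'n"
  assumes cont: "continuous_on (sphere 0 1) Q" and pos: "\<And>\<xi>. norm \<xi> = 1 \<Longrightarrow> 0 < Q \<xi>"
    and z: "z \<noteq> 0" "norm z < 1" and n: "CARD('n) \<ge> 2"
  shows "(LINT \<xi>|sphere_measure. ln \<bar>z \<bullet> \<xi>\<bar> / Q \<xi>) < 0"
proof -
  define v where "v = z /\<^sub>R norm z"
  have "norm v = 1" "z = norm z *\<^sub>R v" using z by (simp_all add: v_def)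
  have le1: "\<bar>z \<bullet> \<xi>\<bar> < 1" if "norm \<xi> = 1" for \<xi>
    using Cauchy_Schwarz_ineq2[of z \<xi>] that z by simp
  have nonneg: "0 \<le> - ln \<bar>z \<bullet> \<xi>\<bar> / Q \<xi>" if "norm \<xi> = 1" for \<xi>
  proof -
    have "ln \<bar>z \<bullet> \<xi>\<bar> \<le> 0" using le1[OF that] by (cases "z \<bullet> \<xi> = 0") simp_all
    then show ?thesis using pos[OF that] by (simp add: divide_nonpos_pos)
  qed
  have meas: "(\<lambda>\<xi>. - ln \<bar>z \<bullet> \<xi>\<bar> / Q \<xi>) \<in> borel_measurable sphere_measure"
  proof -
    have "(\<lambda>\<xi>. ln \<bar>z \<bullet> \<xi>\<bar>) \<in> borel_measurable sphere_measure"
      using measurable_comp[OF abs_inner_measurable_sphere borel_measurable_ln[OF measurable_ident]]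
      by (simp add: comp_def)
    then show ?thesis
      using continuous_on_measurable_sphere_measure[OF cont] by simp
  qed
  have "continuous_on (sphere 0 1) (\<lambda>\<xi>. inverse (Q \<xi>))"
    using pos by (intro continuous_on_inverse cont) force
  then have "bounded ((\<lambda>\<xi>. inverse (Q \<xi>)) ` sphere 0 1)"
    by (intro compact_imp_bounded compact_continuous_image compact_sphere)
  then obtain B where B: "\<forall>q \<in> (\<lambda>\<xi>. inverse (Q \<xi>)) ` sphere 0 1. norm q \<le> B"
    unfolding bounded_iff by blast
  \<comment> \<open>Scaling to the unit vector \<open>v\<close> splits off the constant
    \<open>ln (norm z)\<close>, and \<open>1 / Q\<close> is bounded on the sphere.\<close>
  have int: "integrable sphere_measure (\<lambda>\<xi>. - ln \<bar>z \<bullet> \<xi>\<bar> / Q \<xi>)"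
  proof (rule Bochner_Integration.integrable_bound[OF _ meas])
    show "integrable sphere_measure (\<lambda>\<xi>. B * (\<bar>ln (norm z)\<bar> + \<bar>ln \<bar>v \<bullet> \<xi>\<bar>\<bar>))"
      using integrable_ln_abs_inner[OF \<open>norm v = 1\<close>] by simp
    show "AE \<xi> in sphere_measure. norm (- ln \<bar>z \<bullet> \<xi>\<bar> / Q \<xi>) \<le> norm (B * (\<bar>ln (norm z)\<bar> + \<bar>ln \<bar>v \<bullet> \<xi>\<bar>\<bar>))"
    proof (rule AE_I2)
      fix \<xi> :: "real^'n" assume "\<xi> \<in> space sphere_measure"
      then have "norm \<xi> = 1" by simp
      have QB: "\<bar>inverse (Q \<xi>)\<bar> \<le> B" using B \<open>norm \<xi> = 1\<close> by simp
      have "z \<bullet> \<xi> = norm z * (v \<bullet> \<xi>)"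
        using z by (simp add: v_def)
      then have "\<bar>ln \<bar>z \<bullet> \<xi>\<bar>\<bar> \<le> \<bar>ln (norm z)\<bar> + \<bar>ln \<bar>v \<bullet> \<xi>\<bar>\<bar>"
        using z abs_triangle_ineq[of "ln (norm z)" "ln \<bar>v \<bullet> \<xi>\<bar>"]
        by (cases "v \<bullet> \<xi> = 0") (simp_all add: abs_mult ln_mult del: abs_triangle_ineq)
      then have "\<bar>ln \<bar>z \<bullet> \<xi>\<bar>\<bar> * \<bar>inverse (Q \<xi>)\<bar> \<le> (\<bar>ln (norm z)\<bar> + \<bar>ln \<bar>v \<bullet> \<xi>\<bar>\<bar>) * B"
        using QB by (intro mult_mono) auto
      also have "\<dots> \<le> \<bar>B * (\<bar>ln (norm z)\<bar> + \<bar>ln \<bar>v \<bullet> \<xi>\<bar>\<bar>)\<bar>"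
        by (simp add: mult.commute)
      finally show "norm (- ln \<bar>z \<bullet> \<xi>\<bar> / Q \<xi>) \<le> norm (B * (\<bar>ln (norm z)\<bar> + \<bar>ln \<bar>v \<bullet> \<xi>\<bar>\<bar>))"
        by (simp add: abs_mult divide_inverse)
    qed
  qed
  have "(LINT \<xi>|sphere_measure. - ln \<bar>z \<bullet> \<xi>\<bar> / Q \<xi>) \<noteq> 0"
  proof
    assume "(LINT \<xi>|sphere_measure. - ln \<bar>z \<bullet> \<xi>\<bar> / Q \<xi>) = 0"
    then have "AE \<xi> in sphere_measure. - ln \<bar>z \<bullet> \<xi>\<bar> / Q \<xi> = 0"
      using nonneg by (subst integral_nonneg_eq_0_iff_AE[OF int, symmetric]) (auto intro!: AE_I2)
    then have "AE \<xi> in sphere_measure. \<bar>z \<bullet> \<xi>\<bar> = 0"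
    proof (rule AE_mp, intro AE_I2 impI)
      fix \<xi> :: "real^'n" assume "\<xi> \<in> space sphere_measure" and 0: "- ln \<bar>z \<bullet> \<xi>\<bar> / Q \<xi> = 0"
      then have "norm \<xi> = 1" by simp
      \<comment> \<open>The logarithm has no zero strictly between 0 and 1, so only the value 0 of
        \<open>\<bar>z \<bullet> \<xi>\<bar>\<close> remains.\<close>
      then have "ln \<bar>z \<bullet> \<xi>\<bar> = 0" using 0 pos[of \<xi>] by simp
      then show "\<bar>z \<bullet> \<xi>\<bar> = 0"
        using le1[OF \<open>norm \<xi> = 1\<close>] by (cases "z \<bullet> \<xi> = 0") simp_all
    qed
    then have "(LINT \<xi>|sphere_measure. \<bar>z \<bullet> \<xi>\<bar>) = 0"
      by (rule integral_eq_zero_AE)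
    then show False
      using mean_projection_pos[where 'a = "real^'n"] n z by (simp add: integral_abs_inner)
  qed
  moreover have "0 \<le> (LINT \<xi>|sphere_measure. - ln \<bar>z \<bullet> \<xi>\<bar> / Q \<xi>)"
    using nonneg by (intro Bochner_Integration.integral_nonneg) auto
  ultimately show ?thesis by simp
qed

theorem corollary1p4:
  fixes L :: "(real^'n \<Rightarrow> real) \<Rightarrow> real^'n \<Rightarrow> real"
    and Q :: "real^'n \<Rightarrow> real"
    and m :: nat
  assumes "m \<ge> 1"
    and "operator_with_symbol m L Q"
    and "uniformly_elliptic m Q"
  shows "(CARD('n) = 2 * m \<longrightarrow>
            (\<exists>r>0. \<forall>x y. x - y \<in> ball 0 r \<and> x \<noteq> y \<longrightarrow> fundamental_solution m Q x y > 0)) \<and>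
         (CARD('n) = 2 * m + 1 \<longrightarrow>
            (\<forall>x y. x \<noteq> y \<longrightarrow> fundamental_solution m Q x y > 0))"
proof (intro conjI impI)
  obtain A where Q: "Q = homogeneous_form m A"
    using assms(2) unfolding operator_with_symbol_def by blast
  have cont: "continuous_on (sphere 0 1) Q" unfolding Q by (rule continuous_on_homogeneous_form)
  have set_int: "(LINT \<xi>:sphere 0 1|hausdorff_measure (CARD('n) - 1). f \<xi>) = (LINT \<xi>|sphere_measure. f \<xi>)"
    for f :: "real^'n \<Rightarrow> real"
    using set_integral_sphere_eq[of f] by simp
  {
    assume n: "CARD('n) = 2 * m"
    \<comment> \<open>The radius 1 works for every operator: it is exactly what keeps
      \<open>\<bar>(x - y) \<bullet> \<xi>\<bar>\<close> below 1 on the sphere.\<close>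
    have "fundamental_solution m Q x y > 0" if xy: "x - y \<in> ball 0 1" "x \<noteq> y" for x y
    proof -
      have "(LINT \<xi>|sphere_measure. ln \<bar>(x - y) \<bullet> \<xi>\<bar> / Q \<xi>) < 0"
        using xy n \<open>m \<ge> 1\<close> elliptic_pos_on_sphere[OF assms(3)] by (intro integral_ln_abs_inner_neg cont) auto
      \<comment> \<open>Here the dimension is even and the Laplacian is iterated 0 times; the
        negative prefactor turns the sign.\<close>
      then show ?thesis
        unfolding fundamental_solution_def set_int using n by (simp add: divide_less_0_iff)
    qed
    then show "\<exists>r>0. \<forall>x y. x - y \<in> ball 0 r \<and> x \<noteq> y \<longrightarrow> fundamental_solution m Q x y > 0"
      by (intro exI[of _ 1]) auto
  next
    assume n: "CARD('n) = 2 * m + 1"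
    have "fundamental_solution m Q x y > 0" if "x \<noteq> y" for x y
    proof -
      have "neg_laplacian (\<lambda>y. weighted_projection Q (x - y)) y < 0"
        using n \<open>m \<ge> 1\<close> by (intro neg_laplacian_weighted_projection_neg[OF Q assms(3) that]) simp
      \<comment> \<open>Here the dimension is odd and \<open>(n + 1 - 2 * m) div 2 = 1\<close>, so a
        single Laplacian is applied.\<close>
      then show ?thesis
        unfolding fundamental_solution_def set_int weighted_projection_def
        using n by (simp add: divide_less_0_iff)
    qed
    then show "\<forall>x y. x \<noteq> y \<longrightarrow> fundamental_solution m Q x y > 0" by blast
  }
qed

end
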